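(* Let $d=p^e d'$ with $p=\mathrm{char}(\mathbb{F}_q)$, $e\geq0$ and $d'\in\mathbb{N}$ prime to $p$. Let $E=C^{\otimes d}$ be the $d$-th tensor power of the Carlitz module and $\varrho_E:\mathrm{Gal}(K^{\mathrm{sep}}/K)\to\mathrm{GL}_1(\mathbb{F}_q[[t]])$ the associated $t$-adic Galois representation. Then the density satisfies $\delta(\varrho_E)=\frac{1}{p^e}$.
   Context: $K=\mathbb{F}_q(\theta)$, $\mathbb{C}_\infty$ the completion of an algebraic closure of $\mathbb{F}_q((1/\theta))$, $K^{\mathrm{sep}}\subset\mathbb{C}_\infty$. The Carlitz module $C$ is $\mathbb{G}_a$ over $K$ with $t$ acting by $x\mapsto\theta x+x^q$; its $t$-motive is $K[t]e$ with $\tau(e)=(t-\theta)e$. The $d$-th tensor power $C^{\otimes d}$ is the Anderson $t$-module (of dimension $d$) whose $t$-motive is the $d$-th tensor power over $K[t]$ of the $t$-motive of $C$, i.e. $K[t]e$ with $\tau(e)=(t-\theta)^de$; concretely it is $\mathbb{G}_a^d$ with $t$ acting by $x\mapsto Nx+Ex^{(q)}$, where $N$ has $\theta$ on the diagonal, $1$ on the superdiagonal, $E$ has a single $1$ in the bottom-left corner, and $x^{(q)}$ is the coordinatewise $q$-th power. $\varrho_E$ is the Galois action on the $t$-adic Tate module $\varprojlim_n E[t^{n+1}]$, a free $\mathbb{F}_q[[t]]$-module of rank $1$. Density: with $D(N)$ the order of the image of $\varrho_E$ composed with reduction modulo $t^N$ and $\Gamma$ the Zariski closure of $\mathrm{im}(\varrho_E)$,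 $\delta(\varrho_E)=\limsup_{N\to\infty}\frac{\log_q D(N)}{N\cdot\dim\Gamma}$. *)

theory Defs
  imports
    Complex_Main
    "HOL-Library.Cardinality"
    "HOL-Library.Extended_Real"
    "HOL-Library.Liminf_Limsup"
    "HOL-Computational_Algebra.Computational_Algebra"
    "HOL-Algebra.Algebraic_Closure_Type"
    "HOL-Analysis.Abstract_Topology"
    "Jordan_Normal_Form.Matrix"
begin

unbundle no fps_syntax

(* Here \<open>'a\<close> is the finite field F_q, so q = CARD('a) and p = CHAR('a). *)
type_synonym 'a K = "'a poly fract"
type_synonym 'a Kbar = "'a poly fract alg_closure"

definition theta :: "'a::{field,finite} Kbar" where
  "theta = to_ac (to_fract [:0, 1:])"

definition const_K :: "'a::{field,finite} \<Rightarrow> 'a Kbar" where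
  "const_K c = to_ac (to_fract [:c:])"

(* The separable closure of K inside an algebraic closure of K: the elements whose minimal
   polynomial over K has only simple roots.  Any two separable closures of K are K-isomorphic,
   so this may be identified with the one inside the completion C_infinity. *)
definition Ksep :: "'a::{field,finite} Kbar set" where
  "Ksep = {x. \<exists>f :: 'a K poly. irreducible f \<and> poly (map_poly to_ac f) x = 0
                                \<and> rsquarefree (map_poly to_ac f)}"

(* Field automorphisms of Ksep fixing K; they are extensional functions, so that each
   automorphism is represented by exactly one function. *)
definition Gal :: "('a::{field,finite} Kbar \<Rightarrow> 'a Kbar) set" where
  "Gal = {\<sigma> \<in> extensional Ksep. bij_betw \<sigma> Ksep Ksep
            \<and> (\<forall>x\<in>Ksep. \<forall>y\<in>Ksep. \<sigma> (x + y) = \<sigma> x + \<sigma> y \<and> \<sigma> (x * y) = \<sigma> x * \<sigma> y)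
            \<and> (\<forall>a :: 'a K. \<sigma> (to_ac a) = to_ac a)}"

(* The d-th tensor power of the Carlitz module: the action of t on G_a^d, x \<mapsto> N x + E x^(q). *)
definition carlitz_N :: "nat \<Rightarrow> 'a::{field,finite} Kbar mat" where
  "carlitz_N d = mat d d (\<lambda>(i, j). if j = i then theta else if j = Suc i then 1 else 0)"

definition carlitz_E :: "nat \<Rightarrow> 'a::{field,finite} Kbar mat" where
  "carlitz_E d = mat d d (\<lambda>(i, j). if i = d - 1 \<and> j = 0 then 1 else 0)"

definition carlitz_t :: "nat \<Rightarrow> 'a::{field,finite} Kbar vec \<Rightarrow> 'a Kbar vec" where
  "carlitz_t d x = carlitz_N d *\<^sub>v x + carlitz_E d *\<^sub>v map_vec (\<lambda>y. y ^ CARD('a)) x"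

(* E[t^n] for E = C^{(x) d}, as a set of Ksep-rational points *)
definition torsion :: "nat \<Rightarrow> nat \<Rightarrow> 'a::{field,finite} Kbar vec set" where
  "torsion d n = {x \<in> carrier_vec d. (\<forall>i<d. x $ i \<in> Ksep) \<and> (carlitz_t d ^^ n) x = 0\<^sub>v d}"

(* The projective limit of the E[t^(n+1)] along multiplication by t *)
definition tate_module :: "nat \<Rightarrow> (nat \<Rightarrow> 'a::{field,finite} Kbar vec) set" where
  "tate_module d = {x. (\<forall>n. x n \<in> torsion d (Suc n)) \<and> (\<forall>n. carlitz_t d (x (Suc n)) = x n)}"

(* The F_q[[t]]-module structure: on E[t^(n+1)] a power series acts through its
   coefficients of index at most n. *)
definition tate_smult ::
  "nat \<Rightarrow> 'a::{field,finite} fps \<Rightarrow> (nat \<Rightarrow> 'a Kbar vec) \<Rightarrow> nat \<Rightarrow> 'a Kbar vec" where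
  "tate_smult d u x n =
     vec d (\<lambda>j. \<Sum>i\<le>n. const_K (fps_nth u i) * ((carlitz_t d ^^ i) (x n) $ j))"

(* The Tate module is free of rank 1, so an F_q[[t]]-linear automorphism is multiplication by a
   unique unit of F_q[[t]], its matrix in GL_1(F_q[[t]]) with respect to any basis. *)
definition galois_rep :: "nat \<Rightarrow> ('a::{field,finite} Kbar \<Rightarrow> 'a Kbar) \<Rightarrow> 'a fps" where
  "galois_rep d \<sigma> = (THE u. is_unit u \<and>
     (\<forall>x \<in> tate_module d. (\<lambda>n. map_vec \<sigma> (x n)) = tate_smult d u x))"

(* The Zariski topology on GL_1(F) = F - {0}.  The regular functions are the Laurent polynomials;
   since x is invertible there, they have the same zero loci as ordinary polynomials. *)
definition zariski_GL1 :: "'b::field topology" where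
  "zariski_GL1 = topology (\<lambda>U. \<exists>P :: 'b poly set. U = {x. x \<noteq> 0 \<and> \<not> (\<forall>f\<in>P. poly f x = 0)})"

lemma openin_zariski_GL1:
  fixes U :: "'b::field set"
  shows "openin zariski_GL1 U \<longleftrightarrow>
    (\<exists>P :: 'b poly set. U = {x. x \<noteq> 0 \<and> \<not> (\<forall>f\<in>P. poly f x = 0)})"
proof -
  let ?D = "\<lambda>P :: 'b poly set. {x. x \<noteq> 0 \<and> \<not> (\<forall>f\<in>P. poly f x = 0)}"
  have "istopology (\<lambda>U. \<exists>P. U = ?D P)"
    unfolding istopology_def
  proof (intro conjI allI impI)
    fix S T assume "\<exists>P. S = ?D P" "\<exists>P. T = ?D P"
    then show "\<exists>P. S \<inter> T = ?D P"
    proof (elim exE)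
      fix P Q assume S: "S = ?D P" and T: "T = ?D Q"
      have "S \<inter> T = ?D ((\<lambda>(f, g). f * g) ` (P \<times> Q))"
        unfolding S T by (auto simp: split_def Bex_def)
      then show ?thesis by (rule exI)
    qed
  next
    fix \<K> assume "\<forall>S\<in>\<K>. \<exists>P. S = ?D P"
    then obtain P where P: "\<forall>S\<in>\<K>. S = ?D (P S)" by (rule bchoice [THEN exE])
    have "\<Union>\<K> = (\<Union>S\<in>\<K>. S)" by simp
    also have "\<dots> = (\<Union>S\<in>\<K>. ?D (P S))" using P by (intro SUP_cong) simp_all
    also have "\<dots> = ?D (\<Union>S\<in>\<K>. P S)" by auto
    finally show "\<exists>P. \<Union>\<K> = ?D P" by (rule exI)
  qed
  then show ?thesis
    by (simp add: zariski_GL1_def)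
qed

definition irreducible_closedin :: "'b topology \<Rightarrow> 'b set \<Rightarrow> bool" where
  "irreducible_closedin T C \<longleftrightarrow> closedin T C \<and> C \<noteq> {} \<and>
     (\<forall>A B. closedin T A \<and> closedin T B \<and> C = A \<union> B \<longrightarrow> C = A \<or> C = B)"

(* Krull dimension of a topological space *)
definition krull_dim :: "'b topology \<Rightarrow> enat" where
  "krull_dim T = Sup {enat n | n. \<exists>C. (\<forall>i\<le>n. irreducible_closedin T (C i))
                                    \<and> (\<forall>i<n. C i \<subset> C (Suc i))}"

(* The Zariski closure is taken in the algebraic group GL_1 over F_q((t)), viewed through its
   points over an algebraic closure of F_q((t)). *)
definition zariski_hull :: "'a::field fps set \<Rightarrow> 'a fls alg_closure set" where
  "zariski_hull I = Abstract_Topology.closure_of zariski_GL1 ((\<lambda>u. to_ac (fps_to_fls u)) ` I)"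

definition hull_dim :: "'a::field fps set \<Rightarrow> enat" where
  "hull_dim I = krull_dim (subtopology zariski_GL1 (zariski_hull I))"

(* D(N), the order of the image of \<open>\<rho>\<close> modulo t^N *)
definition image_order :: "'g set \<Rightarrow> ('g \<Rightarrow> 'a::{field,finite} fps) \<Rightarrow> nat \<Rightarrow> nat" where
  "image_order G \<rho> N = card ((\<lambda>\<sigma>. \<rho> \<sigma> mod fps_X ^ N) ` G)"

definition density :: "'g set \<Rightarrow> ('g \<Rightarrow> 'a::{field,finite} fps) \<Rightarrow> ereal" where
  "density G \<rho> = limsup (\<lambda>N. ereal (log (real CARD('a)) (real (image_order G \<rho> N)))
                                / (ereal (real N) * ereal_of_enat (hull_dim (\<rho> ` G))))"

end

theory Submission
  imports Defs "Jordan_Normal_Form.Char_Poly" "HOL-Real_Asymp.Real_Asymp"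
begin

text \<open>
  A point of the Tate module of \<open>C\<^sup>\<otimes>\<^sup>d\<close> is determined by its first coordinates, read as a power
  series \<open>f\<close> in \<open>t\<close> over \<open>K\<^sup>s\<^sup>e\<^sup>p\<close>, and the condition on \<open>f\<close> is \<open>f\<^sup>(\<^sup>1\<^sup>) = (t - \<theta>)\<^sup>d f\<close>, where \<open>(1)\<close> is
  the Frobenius on coefficients.  If \<open>\<omega>\<close> solves this for \<open>d = 1\<close> with nonzero constant term, then
  the solutions for \<open>d\<close> are the \<open>F\<^sub>q[[t]]\<close>-multiples of \<open>\<omega>\<^sup>d\<close>; so if \<open>\<sigma> \<omega> = u \<omega>\<close>, then \<open>\<sigma>\<close> acts on the
  Tate module of \<open>C\<^sup>\<otimes>\<^sup>d\<close> by \<open>u\<^sup>d\<close>.  The \<open>t\<^sup>N\<close>-torsion points of \<open>C\<close> of exact order \<open>t\<^sup>N\<close> are conjugate,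
  being the roots of an Eisenstein polynomial at \<open>\<theta>\<close>, so modulo \<open>t\<^sup>N\<close> every unit occurs as \<open>u\<close>.
  The image of the representation modulo \<open>t\<^sup>N\<close> therefore consists of the \<open>d\<close>-th powers of units.
  Raising to the power \<open>d'\<close> is injective on 1-units, while raising to the power \<open>p\<^sup>e\<close> turns a
  congruence modulo \<open>t\<^sup>M\<close> into one modulo \<open>t\<close> to the power \<open>p\<^sup>e M\<close>; so the order of the image lies
  between \<open>q\<close> to the powers \<open>M - 1\<close> and \<open>M\<close>, where \<open>M\<close> is \<open>N / p\<^sup>e\<close> rounded up.  The image is
  infinite, hence Zariski dense in \<open>GL\<^sub>1\<close>, which has dimension 1.
\<close>

interpretation to_ac: field_hom to_ac by standard auto
interpretation map_poly_to_ac: map_poly_inj_idom_hom to_ac ..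

section \<open>Extension of field homomorphisms\<close>

text \<open>Take a nonzero annihilating polynomial m of least degree. The remainder of any other
  annihilator modulo m has smaller degree and so vanishes. If m = a * b, one factor has x as a root,
  hence is a multiple of m, and the other is a unit.\<close>

lemma minimal_polynomial_exists:
  fixes x :: "'k::field alg_closure"
  shows "\<exists>m :: 'k poly. irreducible m \<and> poly (map_poly to_ac m) x = 0
    \<and> (\<forall>f. poly (map_poly to_ac f) x = 0 \<longrightarrow> m dvd f)"
proof -
  let ?P = "\<lambda>m::'k poly. m \<noteq> 0 \<and> poly (map_poly to_ac m) x = 0"
  obtain p :: "'k poly" where "?P p"
    using alg_closure_algebraic[of x] by blast
  then obtain m where m: "?P m" and min: "\<And>f. ?P f \<Longrightarrow> degree m \<le> degree f"
    using ex_has_least_nat[of ?P p degree] by blast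
  have dvd: "m dvd f" if "poly (map_poly to_ac f) x = 0" for f
  proof -
    have "poly (map_poly to_ac (f mod m)) x = 0"
      using that m by (simp add: minus_mult_div_eq_mod[symmetric] hom_distribs)
    then have "f mod m = 0"
      using min[of "f mod m"] degree_mod_less'[of m f] m by fastforce
    then show ?thesis by (simp add: dvd_eq_mod_eq_0)
  qed
  have "irreducible m"
  proof (rule irreducibleI)
    show "m \<noteq> 0" using m by simp
    show "\<not> m dvd 1"
    proof
      assume "m dvd 1"
      then have "degree m = 0" by (simp add: is_unit_iff_degree[OF conjunct1[OF m]])
      then show False using m by (auto elim!: degree_eq_zeroE simp: hom_distribs)
    qed
    fix a b assume ab: "m = a * b"
    have *: "is_unit b'" if "m = a' * b'" "poly (map_poly to_ac a') x = 0" for a' b'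
    proof -
      have "m dvd a'" using dvd that by blast
      then have "a' * b' dvd a' * 1" using that by simp
      moreover have "a' \<noteq> 0" using m that by auto
      ultimately show ?thesis using dvd_times_left_cancel_iff by blast
    qed
    have "poly (map_poly to_ac a) x = 0 \<or> poly (map_poly to_ac b) x = 0"
      using m ab by (auto simp: hom_distribs)
    then show "is_unit a \<or> is_unit b"
      using *[of a b] *[of b a] ab by (auto simp: mult.commute)
  qed
  then show ?thesis using m dvd by blast
qed

lemma irreducible_dvd_of_root:
  fixes x :: "'k::field alg_closure"
  assumes "irreducible \<phi>" "poly (map_poly to_ac \<phi>) x = 0" "poly (map_poly to_ac f) x = 0"
  shows "\<phi> dvd f"
proof -
  obtain m :: "'k poly" where m: "irreducible m"
    "\<And>f. poly (map_poly to_ac f) x = 0 \<Longrightarrow> m dvd f"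
    using minimal_polynomial_exists[of x] by blast
  obtain k where k: "\<phi> = m * k" using m(2)[OF assms(2)] by (elim dvdE)
  then have "is_unit k"
    using irreducibleD[OF assms(1) k] irreducible_not_unit[OF m(1)] by blast
  then show ?thesis using m(2)[OF assms(3)] k by (simp add: mult_unit_dvd_iff)
qed

text \<open>A homomorphism over the base field from a subring of the algebraic closure, given by its
  graph, so that Zorn's lemma applies to inclusion.  The domain is automatically a field.\<close>

locale partial_hom =
  fixes G :: "('k::field alg_closure \<times> 'k alg_closure) set"
  assumes const: "(to_ac c, to_ac c) \<in> G"
    and add: "(x, x') \<in> G \<Longrightarrow> (y, y') \<in> G \<Longrightarrow> (x + y, x' + y') \<in> G"
    and mult: "(x, x') \<in> G \<Longrightarrow> (y, y') \<in> G \<Longrightarrow> (x * y, x' * y') \<in> G"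
    and zeroD: "(0, y) \<in> G \<Longrightarrow> y = 0"
begin

lemma zero: "(0, 0) \<in> G" and one: "(1, 1) \<in> G"
  using const[of 0] const[of 1] by simp_all

lemma uminus: "(x, x') \<in> G \<Longrightarrow> (- x, - x') \<in> G"
  using mult[OF const[of "-1"]] by force

lemma diff: "(x, x') \<in> G \<Longrightarrow> (y, y') \<in> G \<Longrightarrow> (x - y, x' - y') \<in> G"
  using add[OF _ uminus, of x x' y y'] by simp

lemma sum: "(\<And>i. i \<in> I \<Longrightarrow> (f i, g i) \<in> G) \<Longrightarrow> (\<Sum>i\<in>I. f i, \<Sum>i\<in>I. g i) \<in> G"
  by (induction I rule: infinite_finite_induct) (auto intro: add zero)

lemma functional: "(x, y) \<in> G \<Longrightarrow> (x, y') \<in> G \<Longrightarrow> y = y'"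
  using diff[of x y x y'] zeroD[of "y - y'"] by simp

lemma eval: "(a, a') \<in> G \<Longrightarrow> (poly (map_poly to_ac g) a, poly (map_poly to_ac g) a') \<in> G"
  by (induction g) (auto simp: hom_distribs intro!: add mult const zero)

text \<open>If m = c + X g is the minimal polynomial of a, then c is nonzero, since otherwise g
  would be an annihilator of smaller degree. So 1/a = - g(a) / c is a polynomial expression in a and
  lies in the domain.\<close>

lemma inverse:
  assumes "(a, a') \<in> G" "a \<noteq> 0"
  obtains b where "(inverse a, b) \<in> G"
proof -
  obtain m :: "'k poly" where m: "irreducible m" "poly (map_poly to_ac m) a = 0"
    "\<And>f. poly (map_poly to_ac f) a = 0 \<Longrightarrow> m dvd f"
    using minimal_polynomial_exists[of a] by blast
  obtain c g where mc: "m = pCons c g" by (cases m)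
  have "c \<noteq> 0"
  proof
    assume "c = 0"
    then have "poly (map_poly to_ac g) a = 0"
      using m(2) assms(2) by (simp add: mc hom_distribs)
    then have "m dvd g" by (rule m(3))
    moreover have "g \<noteq> 0" using \<open>c = 0\<close> m(1) mc by auto
    ultimately show False using dvd_imp_degree_le[of m g] mc by simp
  qed
  have "a * poly (map_poly to_ac g) a = - to_ac c"
    using m(2) by (simp add: mc hom_distribs add_eq_0_iff)
  then have "inverse a = to_ac (- inverse c) * poly (map_poly to_ac g) a"
    using assms(2) \<open>c \<noteq> 0\<close> by (simp add: field_simps)
  then show ?thesis
    using mult[OF const eval[OF assms(1)], of "- inverse c" g] that by metis
qed

lemma injective: assumes "(x, 0) \<in> G" shows "x = 0"
proof (rule ccontr)
  assume "x \<noteq> 0"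
  then obtain b where "(inverse x, b) \<in> G" using inverse assms by blast
  then have "(1, 0) \<in> G" using mult[OF assms, of "inverse x" b] \<open>x \<noteq> 0\<close> by simp
  then show False using functional[OF one, of 0] by simp
qed

text \<open>The graph of the map on polynomials that \<open>G\<close> induces coefficient by
  coefficient; pairs avoid choosing values outside the domain of \<open>G\<close>.\<close>

definition poly_pairs :: "('k alg_closure poly \<times> 'k alg_closure poly) set" where
  "poly_pairs = {(p, p'). \<forall>i. (coeff p i, coeff p' i) \<in> G}"

lemma poly_pairs_add:
  "(p, p') \<in> poly_pairs \<Longrightarrow> (q, q') \<in> poly_pairs \<Longrightarrow> (p + q, p' + q') \<in> poly_pairs"
  by (auto simp: poly_pairs_def intro: add)

lemma poly_pairs_diff:
  "(p, p') \<in> poly_pairs \<Longrightarrow> (q, q') \<in> poly_pairs \<Longrightarrow> (p - q, p' - q') \<in> poly_pairs"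
  by (auto simp: poly_pairs_def intro: diff)

lemma poly_pairs_mult:
  "(p, p') \<in> poly_pairs \<Longrightarrow> (q, q') \<in> poly_pairs \<Longrightarrow> (p * q, p' * q') \<in> poly_pairs"
  by (auto simp: poly_pairs_def coeff_mult intro: sum mult)

lemma poly_pairs_monom: "(c, c') \<in> G \<Longrightarrow> (monom c k, monom c' k) \<in> poly_pairs"
  by (auto simp: poly_pairs_def zero)

lemma poly_pairs_map: "(map_poly to_ac p, map_poly to_ac p) \<in> poly_pairs"
  by (auto simp: poly_pairs_def const)

lemma poly_pairs_0: "(0, p') \<in> poly_pairs \<Longrightarrow> p' = 0"
  by (auto simp: poly_pairs_def poly_eq_iff dest: zeroD)

lemma poly_pairs_degree: "(p, p') \<in> poly_pairs \<Longrightarrow> degree p' = degree p"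
proof -
  assume "(p, p') \<in> poly_pairs"
  then have "(coeff p i, coeff p' i) \<in> G" for i by (simp add: poly_pairs_def)
  then have "coeff p i = 0 \<longleftrightarrow> coeff p' i = 0" for i
    using zeroD injective by metis
  then show ?thesis by (simp add: degree_def)
qed

text \<open>The simple extension step: m has least degree among the nonzero polynomials over the
  domain with root x, m' is its image, and x is sent to a root y of m'.\<close>

lemma extend_by_element:
  fixes x :: "'k alg_closure"
  obtains G' y where "G \<subseteq> G'" "partial_hom G'" "(x, y) \<in> G'"
proof -
  let ?P = "\<lambda>(m, m'). (m, m') \<in> poly_pairs \<and> m \<noteq> 0 \<and> poly m x = 0"
  obtain f :: "'k poly" where f: "f \<noteq> 0" "poly (map_poly to_ac f) x = 0"
    using alg_closure_algebraic[of x] by blast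
  then have "?P (map_poly to_ac f, map_poly to_ac f)" by (simp add: poly_pairs_map)
  then obtain z where "?P z" and "\<forall>w. ?P w \<longrightarrow> degree (fst z) \<le> degree (fst w)"
    using ex_has_least_nat[of ?P _ "\<lambda>z. degree (fst z)"] by blast
  then obtain m m' where m: "(m, m') \<in> poly_pairs" "m \<noteq> 0" "poly m x = 0"
    and min: "\<And>p p'. (p, p') \<in> poly_pairs \<Longrightarrow> p \<noteq> 0 \<Longrightarrow> poly p x = 0 \<Longrightarrow> degree m \<le> degree p"
    by (cases z) fastforce
  have "degree m \<noteq> 0"
  proof
    assume "degree m = 0"
    then obtain c where "m = [:c:]" by (rule degree_eq_zeroE)
    then show False using m by simp
  qed
  then have "degree m' > 0" using poly_pairs_degree[OF m(1)] by simp
  then obtain y where y: "poly m' y = 0" using alg_closed_imp_poly_has_root by blast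
  have "(lead_coeff m, coeff m' (degree m)) \<in> G" using m(1) by (simp add: poly_pairs_def)
  then obtain b where b: "(Fields.inverse (lead_coeff m), b) \<in> G"
    using inverse m(2) by (meson leading_coeff_0_iff)
  \<comment> \<open>This makes p(x) -> p'(y) well defined. Division by m is carried out on both
    components at once, one leading term at a time; the inverse of the leading coefficient of m lies
    in the domain.\<close>
  have key: "poly p' y = 0" if "(p, p') \<in> poly_pairs" "poly p x = 0" for p p'
    using that
  proof (induction "degree p" arbitrary: p p' rule: less_induct)
    case less
    show ?case
    proof (cases "p = 0")
      case True then show ?thesis using poly_pairs_0 less.prems by (metis poly_0)
    next
      case False
      let ?k = "degree p - degree m"
      let ?c = "lead_coeff p * Fields.inverse (lead_coeff m)"
      let ?c' = "coeff p' (degree p) * b"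
      let ?q = "p - monom ?c ?k * m" and ?q' = "p' - monom ?c' ?k * m'"
      have le: "degree m \<le> degree p" using min less.prems False by blast
      have "(?c, ?c') \<in> G" using less.prems(1) b by (auto simp: poly_pairs_def intro: mult)
      then have q: "(?q, ?q') \<in> poly_pairs"
        using less.prems(1) m(1) by (intro poly_pairs_diff poly_pairs_mult poly_pairs_monom)
      have qx: "poly ?q x = 0" using less.prems m by simp
      have "coeff ?q (degree p) = 0"
        using le m(2) by (simp add: coeff_monom_mult)
      moreover have "degree ?q \<le> degree p"
        by (intro degree_diff_le order.refl order.trans[OF degree_mult_le]
            order.trans[OF add_mono[OF degree_monom_le order.refl]]) (use le in simp)
      ultimately have "?q = 0 \<or> degree ?q < degree p"
        by (cases "degree ?q = degree p") (use leading_coeff_0_iff[of ?q] in \<open>presburger, linarith\<close>)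
      then have "poly ?q' y = 0"
      proof
        assume "?q = 0"
        then have "?q' = 0" by (intro poly_pairs_0 q[unfolded \<open>?q = 0\<close>])
        then show ?thesis by simp
      qed (rule less.hyps[OF _ q qx])
      then show ?thesis using y by simp
    qed
  qed
  define G' where "G' = {(poly p x, poly p' y) |p p'. (p, p') \<in> poly_pairs}"
  have sub: "G \<subseteq> G'"
  proof
    fix z assume "z \<in> G"
    then have "(monom (fst z) 0, monom (snd z) 0) \<in> poly_pairs" by (intro poly_pairs_monom) simp
    moreover have "z = (poly (monom (fst z) 0) x, poly (monom (snd z) 0) y)"
      by (simp add: poly_monom)
    ultimately show "z \<in> G'" unfolding G'_def by blast
  qed
  have "partial_hom G'"
  proof
    show "(to_ac c, to_ac c) \<in> G'" for c using sub const by blast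
    show "y = 0" if "(0, y) \<in> G'" for y using that key unfolding G'_def by auto
    fix u u' v v' assume "(u, u') \<in> G'" "(v, v') \<in> G'"
    then obtain p p' q q' where "(p, p') \<in> poly_pairs" "(q, q') \<in> poly_pairs"
      "u = poly p x" "u' = poly p' y" "v = poly q x" "v' = poly q' y"
      unfolding G'_def by auto
    then have "(u + v, u' + v') = (poly (p + q) x, poly (p' + q') y)"
      "(u * v, u' * v') = (poly (p * q) x, poly (p' * q') y)"
      and "(p + q, p' + q') \<in> poly_pairs" "(p * q, p' * q') \<in> poly_pairs"
      by (simp_all add: poly_pairs_add poly_pairs_mult)
    then show "(u + v, u' + v') \<in> G'" "(u * v, u' * v') \<in> G'"
      unfolding G'_def by blast+
  qed
  moreover have "(x, y) \<in> G'"
    using poly_pairs_monom[OF one, of 1] unfolding G'_def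
    by (auto simp: poly_monom intro!: exI[of _ "monom 1 1"])
  ultimately show ?thesis using that sub by blast
qed

end

text \<open>Zorn's lemma gives a maximal partial homomorphism above \<open>G\<close>, and
  \<open>extend_by_element\<close> shows that its domain is everything. Surjectivity on
  \<open>Ksep\<close> is derived later, from the finiteness of root sets.\<close>

lemma extend_to_hom:
  fixes G :: "('k::field alg_closure \<times> 'k alg_closure) set"
  assumes "partial_hom G"
  obtains h where "\<And>x y. (x, y) \<in> G \<Longrightarrow> h x = y" "\<And>x y. h (x + y) = h x + h y"
    "\<And>x y. h (x * y) = h x * h y" "\<And>c. h (to_ac c) = to_ac c" "inj h"
proof -
  let ?S = "{H. partial_hom H \<and> G \<subseteq> H}"
  have "\<exists>M\<in>?S. \<forall>H\<in>?S. M \<subseteq> H \<longrightarrow> H = M"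
  proof (rule subset_Zorn_nonempty)
    show "?S \<noteq> {}" using assms by blast
    fix \<C> assume ne: "\<C> \<noteq> {}" and ch: "subset.chain ?S \<C>"
    from ch have sub: "\<C> \<subseteq> ?S" unfolding subset_chain_def by (rule conjunct1)
    have pair: "\<exists>H\<in>\<C>. z \<in> H \<and> w \<in> H" if "z \<in> \<Union>\<C>" "w \<in> \<Union>\<C>" for z w
    proof -
      obtain H1 H2 where H: "H1 \<in> \<C>" "z \<in> H1" "H2 \<in> \<C>" "w \<in> H2" using \<open>z \<in> \<Union>\<C>\<close> \<open>w \<in> \<Union>\<C>\<close> by blast
      then have "H1 \<subseteq> H2 \<or> H2 \<subseteq> H1" using ch unfolding subset_chain_def by blast
      then show ?thesis using H by blast
    qed
    have "partial_hom (\<Union>\<C>)"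
    proof
      show "(to_ac c, to_ac c) \<in> \<Union>\<C>" for c
        using ne sub unfolding partial_hom_def by blast
      show "y = 0" if "(0, y) \<in> \<Union>\<C>" for y
        using that sub unfolding partial_hom_def by blast
      fix u u' v v' assume "(u, u') \<in> \<Union>\<C>" "(v, v') \<in> \<Union>\<C>"
      then obtain H where "H \<in> \<C>" "(u, u') \<in> H" "(v, v') \<in> H" using pair by meson
      moreover from this have "partial_hom H" using sub by blast
      ultimately show "(u + v, u' + v') \<in> \<Union>\<C>" "(u * v, u' * v') \<in> \<Union>\<C>"
        unfolding partial_hom_def by blast+
    qed
    then show "\<Union>\<C> \<in> ?S" using sub ne by blast
  qed
  then obtain M where M_in: "M \<in> ?S" and M_max: "\<forall>H\<in>?S. M \<subseteq> H \<longrightarrow> H = M" ..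
  then have M: "partial_hom M" "G \<subseteq> M" by simp_all
  have max: "H = M" if "partial_hom H" "M \<subseteq> H" for H
    using M_max that M(2) by auto
  interpret partial_hom M by (rule M)
  have "\<exists>y. (x, y) \<in> M" for x
  proof -
    obtain G' y where "M \<subseteq> G'" "partial_hom G'" "(x, y) \<in> G'" by (rule extend_by_element)
    then show ?thesis using max[of G'] by blast
  qed
  then obtain h where h: "\<And>x. (x, h x) \<in> M" by metis
  have eq: "h x = y" if "(x, y) \<in> M" for x y using functional[OF h that] .
  show ?thesis
  proof (rule that)
    show "h x = y" if "(x, y) \<in> G" for x y using eq M(2) that by blast
    show "h (x + y) = h x + h y" for x y by (rule eq[OF add[OF h h]])
    show "h (x * y) = h x * h y" for x y by (rule eq[OF mult[OF h h]])
    show "h (to_ac c) = to_ac c" for c by (rule eq[OF const])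
    show "inj h"
    proof (rule injI)
      fix x y assume "h x = h y"
      then have "(x - y, 0) \<in> M" using diff[OF h h, of x y] by simp
      then show "x = y" using injective[of "x - y"] by simp
    qed
  qed
qed

text \<open>The assignment f(a) -> f(b) is well defined, because \<phi> divides every f that
  vanishes at a; it is then extended to the whole algebraic closure.\<close>

lemma conjugating_hom:
  fixes a b :: "'k::field alg_closure"
  assumes "irreducible \<phi>" "poly (map_poly to_ac \<phi>) a = 0" "poly (map_poly to_ac \<phi>) b = 0"
  obtains h :: "'k alg_closure \<Rightarrow> 'k alg_closure" where "h a = b" "\<And>x y. h (x + y) = h x + h y"
    "\<And>x y. h (x * y) = h x * h y" "\<And>c. h (to_ac c) = to_ac c" "inj h"
proof -
  let ?ev = "\<lambda>f x. poly (map_poly to_ac f) x"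
  define G where "G = {(?ev f a, ?ev f b) |f. True}"
  have "partial_hom G"
  proof
    show "(to_ac c, to_ac c) \<in> G" for c
      unfolding G_def by (auto intro!: exI[of _ "[:c:]"] simp: hom_distribs)
    show "y = 0" if "(0, y) \<in> G" for y
    proof -
      obtain f where "?ev f a = 0" "y = ?ev f b" using \<open>(0, y) \<in> G\<close> unfolding G_def by auto
      moreover from this obtain k where "f = \<phi> * k"
        using irreducible_dvd_of_root[OF assms(1,2)] by (blast elim: dvdE)
      ultimately show ?thesis using assms(3) by (simp add: hom_distribs)
    qed
    fix u u' v v' assume "(u, u') \<in> G" "(v, v') \<in> G"
    then obtain f g where "u = ?ev f a" "u' = ?ev f b" "v = ?ev g a" "v' = ?ev g b"
      unfolding G_def by auto
    then have "(u + v, u' + v') = (?ev (f + g) a, ?ev (f + g) b)"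
      "(u * v, u' * v') = (?ev (f * g) a, ?ev (f * g) b)" by (simp_all add: hom_distribs)
    then show "(u + v, u' + v') \<in> G" "(u * v, u' * v') \<in> G" unfolding G_def by blast+
  qed
  moreover have "(a, b) \<in> G"
    unfolding G_def by (auto intro!: exI[of _ "[:0, 1:]"] simp: hom_distribs)
  ultimately have ab: "(a, b) \<in> G" and G: "partial_hom G" by simp_all
  show ?thesis
  proof (rule extend_to_hom[OF G])
    fix h :: "'k alg_closure \<Rightarrow> 'k alg_closure"
    assume "\<And>x y. (x, y) \<in> G \<Longrightarrow> h x = y" "\<And>x y. h (x + y) = h x + h y"
      "\<And>x y. h (x * y) = h x * h y" "\<And>c. h (to_ac c) = to_ac c" "inj h"
    then show ?thesis using ab by (intro that[of h])
  qed
qed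

section \<open>The separable closure is a ring\<close>

interpretation ac: vector_space "\<lambda>(c::'k::field) (x::'k alg_closure). to_ac c * x"
  by standard (auto simp: algebra_simps)

lemma independent_family:
  fixes g :: "'i \<Rightarrow> 'k::field alg_closure"
  assumes "finite J" and zero: "\<And>c. (\<Sum>j\<in>J. to_ac (c j) * g j) = 0 \<Longrightarrow> \<forall>j\<in>J. c j = 0"
  shows "inj_on g J" and "ac.independent (g ` J)"
proof -
  show inj: "inj_on g J"
  proof (rule inj_onI, rule ccontr)
    fix i j assume ij: "i \<in> J" "j \<in> J" "g i = g j" "i \<noteq> j"
    \<comment> \<open>A repeated value g i = g j would give the nontrivial relation g i - g j =
      0.\<close>
    let ?c = "\<lambda>k. if k = i then 1 else if k = j then -1 else 0 :: 'k"
    have "(\<Sum>k\<in>J. to_ac (?c k) * g k) = (\<Sum>k\<in>{i, j}. to_ac (?c k) * g k)"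
      using assms(1) ij by (intro sum.mono_neutral_right) auto
    also have "\<dots> = 0" using ij by simp
    finally show False using zero[of ?c] ij(1) by force
  qed
  show "ac.independent (g ` J)"
  proof (rule ac.independent_if_scalars_zero)
    fix u v assume "(\<Sum>x\<in>g ` J. to_ac (u x) * x) = 0" "v \<in> g ` J"
    then show "u v = 0" using zero[of "\<lambda>j. u (g j)"] by (auto simp: sum.reindex[OF inj])
  qed (use assms(1) in simp)
qed

lemma independent_familyD:
  fixes g :: "'i \<Rightarrow> 'k::field alg_closure"
  assumes "finite J" "inj_on g J" "ac.independent (g ` J)" "(\<Sum>j\<in>J. to_ac (c j) * g j) = 0" "j \<in> J"
  shows "c j = 0"
proof -
  let ?u = "\<lambda>v. c (the_inv_into J g v)"
  have "(\<Sum>v\<in>g ` J. to_ac (?u v) * v) = (\<Sum>j\<in>J. to_ac (c j) * g j)"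
    by (subst sum.reindex[OF assms(2)]) (auto simp: the_inv_into_f_f[OF assms(2)] intro!: sum.cong)
  then have "\<forall>v\<in>g ` J. ?u v = 0"
    using assms by (intro ac.independentD[of "g ` J" "g ` J" ?u, THEN ballI]) auto
  then show ?thesis using assms(5) the_inv_into_f_f[OF assms(2,5)] by fastforce
qed

lemma span_mult:
  fixes u v :: "'k::field alg_closure"
  assumes "u \<in> ac.span A" "v \<in> ac.span B"
  shows "u * v \<in> ac.span {a * b |a b. a \<in> A \<and> b \<in> B}"
proof -
  let ?S = "ac.span {a * b |a b. a \<in> A \<and> b \<in> B}"
  have *: "a * v \<in> ?S" if "a \<in> A" for a
    using assms(2)
  proof (induction rule: ac.span_induct_alt)
    case base then show ?case by (simp add: ac.span_zero)
  next
    case (step c x y)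
    have "a * x \<in> ?S" using step that by (intro ac.span_base) auto
    then have "to_ac c * (a * x) + a * y \<in> ?S" using step by (intro ac.span_add ac.span_scale)
    then show ?case by (simp add: algebra_simps)
  qed
  show ?thesis using assms(1)
  proof (induction rule: ac.span_induct_alt)
    case base then show ?case by (simp add: ac.span_zero)
  next
    case (step c x y)
    then have "to_ac c * (x * v) + y * v \<in> ?S" using * by (intro ac.span_add ac.span_scale)
    then show ?case by (simp add: algebra_simps)
  qed
qed

section \<open>Multiple roots and derivatives\<close>

lemma multiple_root:
  fixes P :: "'c::idom poly"
  assumes "P \<noteq> 0" "\<not> rsquarefree P"
  obtains a where "poly P a = 0" "poly (pderiv P) a = 0"
proof -
  obtain a where "order a P \<noteq> 0" "order a P \<noteq> 1" using assms unfolding rsquarefree_def by blast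
  then have "[:- a, 1:] ^ 2 dvd P" using order_1[of a P] power_le_dvd[of "[:-a, 1:]" "order a P" P 2] by simp
  then obtain Q where "P = [:- a, 1:] ^ 2 * Q" by (elim dvdE)
  then have "P = [:- a, 1:] * ([:- a, 1:] * Q)" by (simp only: power2_eq_square mult.assoc)
  then have "poly P a = 0" "poly (pderiv P) a = 0" by (simp_all add: pderiv_mult del: mult_pCons_left)
  then show ?thesis by (rule that)
qed

text \<open>The polynomial splits into linear factors, and a factor occurring twice would give a
  root of order at least 2. So the multiset of roots is a set with as many elements as the
  degree.\<close>

lemma card_roots_rsquarefree:
  fixes P :: "'c::alg_closed_field poly"
  assumes "rsquarefree P"
  shows "card {x. poly P x = 0} = degree P"
proof -
  have P: "P \<noteq> 0" using assms by (simp add: rsquarefree_def)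
  then obtain A where A: "size A = degree P" "P = smult (lead_coeff P) (\<Prod>x\<in>#A. [:-x, 1:])"
    using alg_closed_imp_factorization by blast
  have "count A x \<le> 1" for x
  proof (rule ccontr)
    assume "\<not> count A x \<le> 1"
    then have "{#x, x#} \<subseteq># A" by (auto simp: subseteq_mset_def)
    then obtain B where "A = {#x, x#} + B" by (metis subset_mset.le_iff_add)
    then have "(\<Prod>y\<in>#A. [:- y, 1:]) = [:- x, 1:] ^ 2 * (\<Prod>y\<in>#B. [:- y, 1:])"
      by (simp add: power2_eq_square mult.assoc del: mult_pCons_left)
    then have "[:- x, 1:] ^ 2 dvd P" by (subst A(2)) (simp add: dvd_smult)
    then have "2 \<le> order x P" using P by (simp add: order_divides)
    moreover have "order x P \<le> 1" using assms unfolding rsquarefree_def by (metis le0 order.refl)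
    ultimately show False by simp
  qed
  then have "A = mset_set (set_mset A)"
    by (intro multiset_eqI) (metis One_nat_def Suc_leI count_greater_zero_iff count_mset_set(1,3) finite_set_mset
      le_antisym not_in_iff)
  then have "size A = card (set_mset A)" by (metis size_mset_set)
  moreover have "set_mset A = {x. poly P x = 0}"
    using P by (subst A(2)) (auto simp: poly_prod_mset)
  ultimately show ?thesis using A(1) by simp
qed

lemma degree_pos_if_root:
  fixes f :: "'k::field poly"
  assumes "f \<noteq> 0" "poly (map_poly to_ac f) x = 0"
  shows "degree f > 0"
proof (rule ccontr)
  assume "\<not> degree f > 0"
  then obtain c where "f = [:c:]" by (auto elim: degree_eq_zeroE)
  then show False using assms by (simp add: hom_distribs)
qed

text \<open>The condition that defines \<open>Ksep\<close>, over an arbitrary base field.\<close>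

definition separable :: "'k::field alg_closure \<Rightarrow> bool" where
  "separable x \<longleftrightarrow> (\<exists>f :: 'k poly. irreducible f \<and> poly (map_poly to_ac f) x = 0
                                \<and> rsquarefree (map_poly to_ac f))"

text \<open>A multiple root is shared with the derivative, so the irreducible f would divide the
  nonzero polynomial f' of smaller degree.\<close>

lemma rsquarefree_if_pderiv:
  fixes f :: "'k::field poly"
  assumes f: "irreducible f" "pderiv f \<noteq> 0"
  shows "rsquarefree (map_poly to_ac f)"
proof (rule ccontr)
  assume "\<not> rsquarefree (map_poly to_ac f)"
  moreover have "map_poly to_ac f \<noteq> 0" using f by auto
  ultimately obtain a where a: "poly (map_poly to_ac f) a = 0" "poly (pderiv (map_poly to_ac f)) a = 0"
    by (metis multiple_root)
  then have "f dvd pderiv f"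
    using irreducible_dvd_of_root[OF f(1) a(1)] by (simp add: to_ac.map_poly_pderiv)
  then have "degree f \<le> degree (pderiv f)" using f(2) by (intro dvd_imp_degree_le)
  moreover have "degree (pderiv f) \<le> degree f - 1" by (rule degree_pderiv_le)
  moreover have "degree f \<noteq> 0"
  proof
    assume "degree f = 0"
    then obtain c where "f = [:c:]" by (rule degree_eq_zeroE)
    then show False using f(2) by (simp add: pderiv_pCons)
  qed
  ultimately show False by simp
qed

lemma to_ac_poly_eq_sum:
  fixes h :: "'k::field poly"
  assumes "degree h < n"
  shows "poly (map_poly to_ac h) x = (\<Sum>i<n. to_ac (coeff h i) * x ^ i)"
proof -
  have "poly (map_poly to_ac h) x = (\<Sum>i\<le>degree h. to_ac (coeff h i) * x ^ i)"
    by (simp add: poly_altdef)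
  also have "\<dots> = (\<Sum>i<n. to_ac (coeff h i) * x ^ i)"
    using assms by (intro sum.mono_neutral_left) (auto simp: coeff_eq_0)
  finally show ?thesis .
qed

lemma to_ac_sum_eq_poly:
  fixes c :: "nat \<Rightarrow> 'k::field"
  assumes "n > 0"
  shows "degree (\<Sum>i<n. monom (c i) i) < n"
    and "(\<Sum>i<n. to_ac (c i) * x ^ i) = poly (map_poly to_ac (\<Sum>i<n. monom (c i) i)) x"
    and "i < n \<Longrightarrow> coeff (\<Sum>i<n. monom (c i) i) i = c i"
proof -
  have "degree (\<Sum>i<n. monom (c i) i) \<le> n - 1"
    by (intro degree_sum_le) (auto intro: order.trans[OF degree_monom_le])
  then show deg: "degree (\<Sum>i<n. monom (c i) i) < n" using assms by simp
  have coeff: "coeff (\<Sum>i<n. monom (c i) i) i = (if i < n then c i else 0)" for i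
    by (simp add: coeff_sum)
  then show "i < n \<Longrightarrow> coeff (\<Sum>i<n. monom (c i) i) i = c i" by simp
  show "(\<Sum>i<n. to_ac (c i) * x ^ i) = poly (map_poly to_ac (\<Sum>i<n. monom (c i) i)) x"
    unfolding to_ac_poly_eq_sum[OF deg] by (simp add: coeff)
qed

text \<open>Replace the polynomial X^i by its remainder modulo f.\<close>

lemma power_in_span:
  fixes x :: "'k::field alg_closure"
  assumes f: "f \<noteq> 0" "poly (map_poly to_ac f) x = 0"
  shows "x ^ i \<in> ac.span ((\<lambda>i. x ^ i) ` {..<degree f})"
proof -
  define h k where "h = monom 1 i mod f" and "k = monom 1 i div f"
  have deg: "degree h < degree f"
    using degree_mod_less'[of f "monom 1 i"] f degree_pos_if_root[OF f] unfolding h_def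
    by (cases "monom 1 i mod f = 0") auto
  have "monom 1 i = h + f * k" by (simp add: h_def k_def)
  then have "x ^ i = poly (map_poly to_ac (h + f * k)) x"
    by (metis mult_1 poly_monom to_ac.map_poly_hom_monom to_ac_1)
  also have "\<dots> = poly (map_poly to_ac h) x" using f(2) by (simp add: hom_distribs)
  also have "\<dots> = (\<Sum>j<degree f. to_ac (coeff h j) * x ^ j)" by (rule to_ac_poly_eq_sum[OF deg])
  also have "\<dots> \<in> ac.span ((\<lambda>i. x ^ i) ` {..<degree f})"
    by (intro ac.span_sum ac.span_scale ac.span_base) auto
  finally show ?thesis .
qed

section \<open>A Frobenius criterion for separability\<close>

context
  assumes char_k: "prime CHAR('k::field)"
begin

lemma Frobenius_add: "(x + y :: 'k alg_closure) ^ CHAR('k) = x ^ CHAR('k) + y ^ CHAR('k)"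
  by (rule freshmans_dream) (simp_all add: char_k)

lemma Frobenius_inj: "(x :: 'k alg_closure) ^ CHAR('k) = y ^ CHAR('k) \<Longrightarrow> x = y"
proof -
  assume *: "x ^ CHAR('k) = y ^ CHAR('k)"
  have "(x - y) ^ CHAR('k) + y ^ CHAR('k) = x ^ CHAR('k)" by (simp flip: Frobenius_add)
  then have "(x - y) ^ CHAR('k) = 0" using * by simp
  then show "x = y" by simp
qed

text \<open>The \<open>p\<close>-th powers of the \<open>n\<close> distinct conjugates of \<open>x\<close> are distinct, so the \<open>p\<close>-th power of \<open>x\<close>
  still has degree \<open>n\<close> and its powers span the field generated by \<open>x\<close>.\<close>

lemma separable_in_span_Frobenius:
  fixes x :: "'k alg_closure"
  assumes "separable x"
  shows "x \<in> ac.span (range (\<lambda>i. (x ^ i) ^ CHAR('k)))"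
proof -
  let ?p = "CHAR('k)"
  obtain f :: "'k poly" where f: "irreducible f" "poly (map_poly to_ac f) x = 0"
    "rsquarefree (map_poly to_ac f)" using assms unfolding separable_def by blast
  let ?n = "degree f" and ?R = "{r. poly (map_poly to_ac f) r = 0}"
  have f0: "f \<noteq> 0" using f by auto
  have n: "?n > 0" by (rule degree_pos_if_root[OF f0 f(2)])
  have card_R: "card ?R = ?n" using card_roots_rsquarefree[OF f(3)] by simp
  have g: "g = 0" if "degree g < ?n" "poly (map_poly to_ac g) (x ^ ?p) = 0" for g :: "'k poly"
  proof (rule ccontr)
    assume "g \<noteq> 0"
    have comp: "poly (map_poly to_ac (g \<circ>\<^sub>p monom 1 ?p)) r = poly (map_poly to_ac g) (r ^ ?p)" for r
      by (simp add: to_ac.map_poly_pcompose poly_pcompose poly_monom)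
    have "f dvd g \<circ>\<^sub>p monom 1 ?p"
      using irreducible_dvd_of_root[OF f(1,2)] that(2) comp by simp
    then obtain k where "g \<circ>\<^sub>p monom 1 ?p = f * k" by (elim dvdE)
    then have "poly (map_poly to_ac g) (r ^ ?p) = 0" if "r \<in> ?R" for r
      using that by (simp add: comp[symmetric] hom_distribs)
    then have "(\<lambda>r. r ^ ?p) ` ?R \<subseteq> {s. poly (map_poly to_ac g) s = 0}" by auto
    then have "card ((\<lambda>r. r ^ ?p) ` ?R) \<le> card {s. poly (map_poly to_ac g) s = 0}"
      using \<open>g \<noteq> 0\<close> by (intro card_mono poly_roots_finite) auto
    moreover have "card ((\<lambda>r. r ^ ?p) ` ?R) = ?n"
      using card_R by (subst card_image) (auto intro!: inj_onI dest: Frobenius_inj)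
    moreover have "card {s. poly (map_poly to_ac g) s = 0} \<le> degree g"
      using card_poly_roots_bound[of "map_poly to_ac g"] \<open>g \<noteq> 0\<close> by simp
    ultimately show False using that(1) by simp
  qed
  let ?S = "(\<lambda>i. (x ^ i) ^ ?p) ` {..<?n}" and ?T = "(\<lambda>i. x ^ i) ` {..<?n}"
  have zero: "\<forall>j\<in>{..<?n}. c j = 0" if "(\<Sum>j<?n. to_ac (c j) * (x ^ j) ^ ?p) = 0" for c :: "nat \<Rightarrow> 'k"
  proof -
    have "(\<Sum>j<?n. to_ac (c j) * (x ^ ?p) ^ j) = 0"
      using that by (simp add: power_mult[symmetric] mult.commute)
    then have "(\<Sum>i<?n. monom (c i) i) = 0"
      by (intro g to_ac_sum_eq_poly(1)[OF n] trans[OF to_ac_sum_eq_poly(2)[OF n, symmetric]])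
    then show ?thesis using to_ac_sum_eq_poly(3)[OF n, of _ c] by fastforce
  qed
  note inj = independent_family(1)[OF finite_lessThan zero]
  note indep = independent_family(2)[OF finite_lessThan zero]
  have "x \<in> ac.span ?S"
  \<comment> \<open>Otherwise x together with the n independent elements of \<open>?S\<close> would
    give n + 1 independent elements in the span of the at most n elements of
    \<open>?T\<close>.\<close>
  proof (rule ccontr)
    assume notin: "x \<notin> ac.span ?S"
    have "insert x ?S \<subseteq> ac.span ?T"
      using power_in_span[OF f0 f(2)] power_in_span[OF f0 f(2), of 1]
      by (auto simp: power_mult[symmetric])
    then have "card (insert x ?S) \<le> card ?T"
      using ac.independent_span_bound[OF _ ac.independent_insertI[OF notin indep]] by blast
    moreover have "card (insert x ?S) = Suc ?n"
      using notin ac.span_base[of x ?S] by (subst card_insert_disjoint) (auto simp: card_image[OF inj])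
    moreover have "card ?T \<le> ?n" using card_image_le[of "{..<?n}"] by simp
    ultimately show False by simp
  qed
  then show ?thesis using ac.span_mono[of ?S "range (\<lambda>i. (x ^ i) ^ ?p)"] by blast
qed

lemma span_Frobenius:
  fixes l :: "'k alg_closure"
  assumes "l \<in> ac.span B"
  shows "l ^ CHAR('k) \<in> ac.span ((\<lambda>z. z ^ CHAR('k)) ` B)"
  using assms
proof (induction rule: ac.span_induct_alt)
  case base then show ?case using char_k by (simp add: ac.span_zero power_0_left prime_gt_0_nat)
next
  case (step c x y)
  have "to_ac (c ^ CHAR('k)) * x ^ CHAR('k) + y ^ CHAR('k) \<in> ac.span ((\<lambda>z. z ^ CHAR('k)) ` B)"
    using step by (intro ac.span_add ac.span_scale) (auto intro: ac.span_base)
  then show ?case by (simp add: Frobenius_add power_mult_distrib)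
qed

text \<open>Since a basis \<open>B\<close> of \<open>L\<close> is mapped by the Frobenius to a spanning set of \<open>L\<close> of no larger
  cardinality, its image is independent.  An inseparable minimal polynomial would be a linear
  relation between \<open>p\<close>-th powers of independent elements.\<close>

lemma separable_if_span_Frobenius:
  fixes L :: "'k alg_closure set"
  assumes fin: "finite T" "L \<subseteq> ac.span T" and pow: "\<And>y i. y \<in> L \<Longrightarrow> y ^ i \<in> L"
    and frob: "L \<subseteq> ac.span ((\<lambda>z. z ^ CHAR('k)) ` L)" and y: "y \<in> L"
  shows "separable y"
proof -
  let ?p = "CHAR('k)" and ?F = "\<lambda>z::'k alg_closure. z ^ CHAR('k)"
  obtain m :: "'k poly" where m: "irreducible m" "poly (map_poly to_ac m) y = 0"
    and dvd: "\<And>f. poly (map_poly to_ac f) y = 0 \<Longrightarrow> m dvd f"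
    using minimal_polynomial_exists[of y] by blast
  let ?n = "degree m"
  have m0: "m \<noteq> 0" using m by auto
  have n: "?n > 0" by (rule degree_pos_if_root[OF m0 m(2)])
  have zero: "\<forall>j\<in>{..<?n}. c j = 0" if "(\<Sum>j<?n. to_ac (c j) * y ^ j) = 0" for c :: "nat \<Rightarrow> 'k"
  proof -
    let ?g = "\<Sum>i<?n. monom (c i) i"
    have "m dvd ?g" by (rule dvd[OF trans[OF to_ac_sum_eq_poly(2)[OF n, symmetric] that]])
    then have "?g = 0" using to_ac_sum_eq_poly(1)[OF n, of c] dvd_imp_degree_le[of m ?g] by fastforce
    then show ?thesis using to_ac_sum_eq_poly(3)[OF n, of _ c] by fastforce
  qed
  note inj = independent_family(1)[OF finite_lessThan zero]
  note indep = independent_family(2)[OF finite_lessThan zero]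
  have "(\<lambda>i. y ^ i) ` {..<?n} \<subseteq> L" using pow y by blast
  then obtain B where B: "(\<lambda>i. y ^ i) ` {..<?n} \<subseteq> B" "B \<subseteq> L" "ac.independent B" "L \<subseteq> ac.span B"
    using ac.maximal_independent_subset_extend[OF _ indep] by blast
  have finB: "finite B" using ac.independent_span_bound[OF fin(1) B(3)] B(2) fin(2) by blast
  have "ac.span (?F ` L) \<subseteq> ac.span (?F ` B)"
    using B(4) span_Frobenius by (intro ac.span_minimal) auto
  then have LF: "L \<subseteq> ac.span (?F ` B)" using frob by blast
  have indepF: "ac.independent (?F ` B)"
  proof
    assume "ac.dependent (?F ` B)"
    then obtain a where a: "a \<in> ?F ` B" "a \<in> ac.span (?F ` B - {a})" unfolding ac.dependent_def by blast
    then have "ac.span (?F ` B - {a}) = ac.span (?F ` B)"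
      using ac.span_redundant[OF a(2)] by (simp add: insert_absorb)
    then have "B \<subseteq> ac.span (?F ` B - {a})" using B(2) LF by blast
    then have "card B \<le> card (?F ` B - {a})"
      using ac.independent_span_bound[OF _ B(3), of "?F ` B - {a}"] finB by blast
    also have "\<dots> < card (?F ` B)" using a(1) finB by (intro psubset_card_mono) auto
    also have "\<dots> \<le> card B" by (rule card_image_le[OF finB])
    finally show False by simp
  qed
  have "pderiv m \<noteq> 0"
  proof
    assume pd: "pderiv m = 0"
    \<comment> \<open>A vanishing derivative leaves only exponents divisible by p, so the equation
      for y becomes a relation between p-th powers of powers of y.\<close>
    have c0: "coeff m i = 0" if "\<not> ?p dvd i" for i
    proof -
      have "i > 0" using that by (auto intro: Nat.gr0I)
      then have "of_nat i * coeff m i = 0"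
        using arg_cong[OF pd, of "\<lambda>q. coeff q (i - 1)"] by (simp add: coeff_pderiv)
      then show ?thesis using that by (simp add: of_nat_eq_0_iff_char_dvd)
    qed
    \<comment> \<open>For j < n the indices p * j include every multiple of p up to n, because p is
      at least 2; those beyond n carry zero coefficients.\<close>
    have "(\<Sum>j<?n. to_ac (coeff m (?p * j)) * (y ^ j) ^ ?p) = (\<Sum>i\<in>(\<lambda>j. ?p * j) ` {..<?n}. to_ac (coeff m i) * y ^ i)"
      using char_k by (subst sum.reindex) (auto intro!: inj_onI simp: power_mult[symmetric] mult.commute)
    also have "\<dots> = (\<Sum>i\<le>?n. to_ac (coeff m i) * y ^ i)"
    proof (rule sum.mono_neutral_cong)
      fix i assume i: "i \<in> {..?n} - (\<lambda>j. ?p * j) ` {..<?n}"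
      have "\<not> ?p dvd i"
      proof
        assume "?p dvd i"
        then obtain j where j: "i = ?p * j" by (elim dvdE)
        have "j < ?n"
        proof (cases "j = 0")
          case False
          have "2 * j \<le> ?p * j" using prime_ge_2_nat[OF char_k] by (intro mult_right_mono) auto
          also have "\<dots> \<le> ?n" using i j by simp
          finally show ?thesis using False by linarith
        qed (use n in simp)
        then show False using i j by auto
      qed
      then show "to_ac (coeff m i) * y ^ i = 0" using c0 by simp
    qed (auto simp: coeff_eq_0)
    also have "\<dots> = 0" using m(2) by (simp add: poly_altdef)
    finally have sum0: "(\<Sum>j<?n. to_ac (coeff m (?p * j)) * (y ^ j) ^ ?p) = 0" .
    have "(\<lambda>j. (y ^ j) ^ ?p) ` {..<?n} \<subseteq> ?F ` B" using B(1) by auto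
    then have indep': "ac.independent ((\<lambda>j. (y ^ j) ^ ?p) ` {..<?n})"
      using indepF by (rule ac.independent_mono[rotated])
    have inj': "inj_on (\<lambda>j. (y ^ j) ^ ?p) {..<?n}"
      using inj by (auto simp: inj_on_def dest: Frobenius_inj)
    have c1: "coeff m (?p * j) = 0" if "j < ?n" for j
      using independent_familyD[OF _ inj' indep' sum0] that by simp
    have "coeff m ?n = 0"
    proof (cases "?p dvd ?n")
      case True
      then obtain j where j: "?n = ?p * j" by (elim dvdE)
      then have "0 < j" using n by (auto intro: Nat.gr0I)
      then have "j < ?n" unfolding j using prime_gt_1_nat[OF char_k] by (intro n_less_m_mult_n) auto
      then show ?thesis using c1 j by simp
    qed (rule c0)
    then show False using m0 by simp
  qed
  then show ?thesis using m rsquarefree_if_pderiv unfolding separable_def by blast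
qed

text \<open>The criterion applies to the base field itself, which is spanned by 1, a p-th
  power.\<close>

lemma separable_to_ac: "separable (to_ac (c :: 'k))"
proof (rule separable_if_span_Frobenius)
  show "range to_ac \<subseteq> ac.span {1 :: 'k alg_closure}" "finite {1 :: 'k alg_closure}"
    by (auto simp: ac.span_singleton)
  show "to_ac c \<in> range to_ac" by simp
  show "y ^ i \<in> range to_ac" if "y \<in> range to_ac" for y :: "'k alg_closure" and i
    using that by (auto simp flip: to_ac_power)
  have "1 \<in> (\<lambda>z. z ^ CHAR('k)) ` range (to_ac :: 'k \<Rightarrow> _)" by (auto intro!: image_eqI[of _ _ 1] image_eqI[of _ to_ac 1])
  then have "to_ac c * 1 \<in> ac.span ((\<lambda>z. z ^ CHAR('k)) ` range to_ac)" for c :: 'k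
    by (intro ac.span_scale ac.span_base)
  then show "range to_ac \<subseteq> ac.span ((\<lambda>z. z ^ CHAR('k)) ` range (to_ac :: 'k \<Rightarrow> _))" by auto
qed

text \<open>Both elements lie in the ring L generated by x and y, which is finite-dimensional.
  Powers of x and of y are combinations of p-th powers by
  \<open>separable_in_span_Frobenius\<close>, hence so is all of L, and the criterion applies to
  L.\<close>

lemma
  fixes x y :: "'k alg_closure"
  assumes "separable x" "separable y"
  shows separable_add: "separable (x + y)" and separable_mult: "separable (x * y)"
proof -
  let ?p = "CHAR('k)"
  define M where "M = {x ^ i * y ^ j |i j. True}"
  define L where "L = ac.span M"
  obtain f g :: "'k poly" where fg: "f \<noteq> 0" "poly (map_poly to_ac f) x = 0" "g \<noteq> 0" "poly (map_poly to_ac g) y = 0"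
    using assms unfolding separable_def by auto
  let ?T = "{a * b |a b. a \<in> (\<lambda>i. x ^ i) ` {..<degree f} \<and> b \<in> (\<lambda>i. y ^ i) ` {..<degree g}}"
  have "?T = (\<lambda>(a, b). a * b) ` ((\<lambda>i. x ^ i) ` {..<degree f} \<times> (\<lambda>i. y ^ i) ` {..<degree g})" by auto
  then have fin: "finite ?T" by simp
  have "M \<subseteq> ac.span ?T"
    unfolding M_def using span_mult[OF power_in_span[OF fg(1,2)] power_in_span[OF fg(3,4)]] by blast
  then have LT: "L \<subseteq> ac.span ?T" unfolding L_def by (intro ac.span_minimal) auto
  have MM: "{a * b |a b. a \<in> M \<and> b \<in> M} \<subseteq> M"
  proof safe
    fix a b assume "a \<in> M" "b \<in> M"
    then obtain i j k l where "a = x ^ i * y ^ j" "b = x ^ k * y ^ l" unfolding M_def by blast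
    then have "a * b = x ^ (i + k) * y ^ (j + l)" by (simp add: power_add mult_ac)
    then show "a * b \<in> M" unfolding M_def by blast
  qed
  have mult: "u * v \<in> L" if "u \<in> L" "v \<in> L" for u v
    using span_mult[of u M v M] that ac.span_mono[OF MM] unfolding L_def by blast
  have xy: "x \<in> M" "y \<in> M" "1 \<in> M"
    unfolding M_def by (force intro: exI[of _ 1] exI[of _ 0])+
  then have "1 \<in> L" unfolding L_def by (blast intro: ac.span_base)
  then have pow: "u ^ i \<in> L" if "u \<in> L" for u i
    using that by (induction i) (auto intro: mult)
  have power_span: "z ^ i \<in> ac.span (range (\<lambda>i. (z ^ i) ^ ?p))" if "separable z" for z :: "'k alg_closure" and i
  proof (induction i)
    case 0
    show ?case by (intro ac.span_base) (auto intro!: image_eqI[of _ _ 0])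
  next
    case (Suc i)
    have "{a * b |a b. a \<in> range (\<lambda>i. (z ^ i) ^ ?p) \<and> b \<in> range (\<lambda>i. (z ^ i) ^ ?p)} \<subseteq> range (\<lambda>i. (z ^ i) ^ ?p)"
      by (auto simp flip: power_mult_distrib power_add)
    from ac.span_mono[OF this] show ?case
      using span_mult[OF separable_in_span_Frobenius[OF that] Suc] by auto
  qed
  let ?FL = "(\<lambda>z. z ^ ?p) ` L"
  have "{a * b |a b. a \<in> range (\<lambda>i. (x ^ i) ^ ?p) \<and> b \<in> range (\<lambda>i. (y ^ i) ^ ?p)} \<subseteq> ?FL"
  proof safe
    fix i j
    have "x ^ i * y ^ j \<in> L" unfolding L_def M_def by (intro ac.span_base) blast
    then show "(x ^ i) ^ ?p * (y ^ j) ^ ?p \<in> ?FL"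
      unfolding power_mult_distrib[symmetric] by (rule imageI)
  qed
  from ac.span_mono[OF this] have "M \<subseteq> ac.span ?FL"
    using span_mult[OF power_span[OF assms(1)] power_span[OF assms(2)]] unfolding M_def by blast
  then have frob: "L \<subseteq> ac.span ?FL" unfolding L_def by (intro ac.span_minimal) auto
  have sep: "separable z" if "z \<in> L" for z
    using separable_if_span_Frobenius[OF fin LT pow frob that] by blast
  show "separable (x + y)" "separable (x * y)"
    using xy mult ac.span_add[of x M y] ac.span_base[of x M] ac.span_base[of y M] unfolding L_def
    by (auto intro!: sep simp: L_def)
qed

end

section \<open>Eisenstein polynomials and finite fields\<close>

interpretation to_fract: inj_idom_hom to_fract by standard auto
interpretation map_poly_to_fract: map_poly_inj_idom_hom to_fract ..
interpretation map_poly_at_0: map_poly_idom_hom "\<lambda>p. poly p (0 :: 'c::idom)" ..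

lemma clear_denominators:
  fixes g :: "'r::idom fract poly"
  obtains a G where "a \<noteq> 0" "map_poly to_fract G = smult (to_fract a) g"
proof -
  have "\<exists>a G. a \<noteq> 0 \<and> map_poly to_fract G = smult (to_fract a) g"
  proof (induction g)
    case 0
    show ?case by (intro exI[of _ 1] exI[of _ 0]) auto
  next
    case (pCons c g)
    then obtain a G where G: "a \<noteq> 0" "map_poly to_fract G = smult (to_fract a) g" by blast
    obtain u v where uv: "c = Fract u v" "v \<noteq> 0" by (cases c)
    then have u: "to_fract u = to_fract v * c" by (simp add: to_fract_def eq_fract)
    then have "map_poly to_fract (pCons (a * u) (smult v G)) = smult (to_fract (a * v)) (pCons c g)"
      by (simp add: hom_distribs G(2) u mult_ac)
    then show ?case using G(1) uv(2) by (metis mult_eq_0_iff)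
  qed
  then show ?thesis using that by blast
qed

text \<open>Gauss's lemma at the prime theta, with \<open>poly p 0\<close> as reduction. If theta
  divides c, then G * H reduces to 0, so one of G and H is divisible by theta; cancelling it lowers
  the degree of c.\<close>

lemma remove_content_at_0:
  fixes F :: "'a::field poly poly"
  assumes "c \<noteq> 0" "smult c F = G * H"
  shows "\<exists>c' G' H'. poly c' 0 \<noteq> 0 \<and> smult c' F = G' * H' \<and> degree G' = degree G \<and> degree H' = degree H"
  using assms
proof (induction "degree c" arbitrary: c G H rule: less_induct)
  case less
  show ?case
  proof (cases "poly c 0 = 0")
    case True
    then obtain c1 where c1: "c = [:0, 1:] * c1" using poly_eq_0_iff_dvd[of c 0] by (auto elim: dvdE)
    then have deg: "degree c1 < degree c" "c1 \<noteq> 0" using less.prems(1) by (auto simp: degree_pCons_eq)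
    have divide: "\<exists>G1. G' = smult [:0, 1:] G1 \<and> degree G' = degree G1"
      if "map_poly (\<lambda>p. poly p 0) G' = 0" for G' :: "'a poly poly"
    proof -
      have "poly (coeff G' n) 0 = 0" for n using arg_cong[OF that, of "\<lambda>p. coeff p n"] by simp
      then have "[:[:0, 1:]:] dvd G'" by (simp add: const_poly_dvd_iff dvd_iff_poly_eq_0)
      then obtain G1 where "G' = [:[:0, 1:]:] * G1" by (elim dvdE)
      then show ?thesis by (intro exI[of _ G1]) simp
    qed
    have "map_poly (\<lambda>p. poly p 0) (G * H) = 0"
      unfolding less.prems(2)[symmetric] using True by (simp add: poly_eq_iff)
    then consider "map_poly (\<lambda>p. poly p 0) G = 0" | "map_poly (\<lambda>p. poly p 0) H = 0"
      by (auto simp: hom_distribs)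
    then show ?thesis
    proof cases
      case 1
      then obtain G1 where G1: "G = smult [:0, 1:] G1" "degree G = degree G1" using divide by blast
      have "smult [:0, 1:] (smult c1 F) = smult [:0, 1:] (G1 * H)"
        using less.prems(2) unfolding c1 G1(1) by (simp only: smult_smult mult_smult_left)
      then have "smult c1 F = G1 * H" by (rule smult_cancel[rotated]) simp
      from less.hyps[OF deg this] show ?thesis unfolding G1(2) .
    next
      case 2
      then obtain H1 where H1: "H = smult [:0, 1:] H1" "degree H = degree H1" using divide by blast
      have "smult [:0, 1:] (smult c1 F) = smult [:0, 1:] (G * H1)"
        using less.prems(2) unfolding c1 H1(1) by (simp only: smult_smult mult_smult_right)
      then have "smult c1 F = G * H1" by (rule smult_cancel[rotated]) simp
      from less.hyps[OF deg this] show ?thesis unfolding H1(2) .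
    qed
  qed (use less.prems in blast)
qed

text \<open>A proper factorization yields c F = G' H' with c prime to theta. Both factors reduce to
  polynomials without constant term, so theta^2 divides the constant term c theta, which is
  impossible.\<close>

lemma Eisenstein_at_0:
  fixes F :: "'a::field poly poly"
  assumes red: "map_poly (\<lambda>p. poly p 0) F = monom 1 (degree F)"
    and F0: "coeff F 0 = [:0, 1:]" and n: "degree F > 0"
  shows "irreducible (map_poly to_fract F)"
proof (rule irreducibleI)
  show "map_poly to_fract F \<noteq> 0" using n by auto
  show "\<not> map_poly to_fract F dvd 1" using n by (auto simp: is_unit_iff_degree)
  fix g h assume gh: "map_poly to_fract F = g * h"
  have gh0: "g \<noteq> 0" "h \<noteq> 0" using n gh by auto
  show "is_unit g \<or> is_unit h"
  proof (rule ccontr)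
    assume "\<not> (is_unit g \<or> is_unit h)"
    then have deg: "degree g > 0" "degree h > 0" using gh0 by (auto simp: is_unit_iff_degree)
    have deg_sum: "degree F = degree g + degree h"
      using arg_cong[OF gh, of degree] gh0 by (simp add: degree_mult_eq)
    obtain a G where G: "a \<noteq> 0" "map_poly to_fract G = smult (to_fract a) g" by (rule clear_denominators)
    obtain b H where H: "b \<noteq> 0" "map_poly to_fract H = smult (to_fract b) h" by (rule clear_denominators)
    have "map_poly to_fract (smult (a * b) F) = map_poly to_fract (G * H)"
      by (simp add: hom_distribs gh G(2) H(2) mult_ac)
    then have "smult (a * b) F = G * H" by (rule map_poly_to_fract.injectivity)
    moreover have "degree G = degree g" "degree H = degree h"
      using arg_cong[OF G(2), of degree] arg_cong[OF H(2), of degree] G(1) H(1) by simp_all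
    ultimately obtain c G' H' where c: "poly c 0 \<noteq> 0" "smult c F = G' * H'"
      and deg': "degree G' = degree g" "degree H' = degree h"
      using remove_content_at_0[of "a * b" F G H] G(1) H(1) by auto
    let ?r = "map_poly (\<lambda>p. poly p (0::'a))"
    have rGH: "?r G' * ?r H' = smult (poly c 0) (monom 1 (degree F))"
      using arg_cong[OF c(2), of ?r] red by (simp add: hom_distribs)
    then have nz: "?r G' \<noteq> 0" "?r H' \<noteq> 0" using c(1) by auto
    \<comment> \<open>The orders at 0 of the two reductions add up to the degree of F, while each is
      at most the degree of its factor; hence both are positive.\<close>
    have "order 0 (monom (1::'a) (degree F)) = degree F"
      using order_power_n_n[of "0::'a" "degree F"] by (simp add: monom_altdef)
    then have "order 0 (?r G' * ?r H') = degree F"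
      unfolding rGH using c(1) by (simp add: order_smult)
    then have "order 0 (?r G') + order 0 (?r H') = degree F" using nz by (simp add: order_mult)
    moreover have "order 0 (?r G') \<le> degree g" "order 0 (?r H') \<le> degree h"
      using order_degree[OF nz(1), of 0] order_degree[OF nz(2), of 0]
        degree_map_poly_le[of "\<lambda>p. poly p (0::'a)" G'] degree_map_poly_le[of "\<lambda>p. poly p (0::'a)" H'] deg'
      by linarith+
    ultimately have "order 0 (?r G') > 0" "order 0 (?r H') > 0" using deg deg_sum by linarith+
    then have "poly (?r G') 0 = 0" "poly (?r H') 0 = 0" by (simp_all only: order_root) simp_all
    then have "poly (coeff G' 0) 0 = 0" "poly (coeff H' 0) 0 = 0"
      unfolding poly_0_coeff_0[of "?r G'"] poly_0_coeff_0[of "?r H'"] by (simp_all add: coeff_map_poly)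
    then have "[:0, 1:] dvd coeff G' 0" "[:0, 1:] dvd coeff H' 0" by (simp_all add: dvd_iff_poly_eq_0)
    then have "[:0, 1:] * [:0, 1:] dvd coeff G' 0 * coeff H' 0" by (rule mult_dvd_mono)
    also have "coeff G' 0 * coeff H' 0 = coeff (smult c F) 0" unfolding c(2) by (simp add: coeff_mult_0)
    also have "\<dots> = [:0, 1:] * c" unfolding coeff_smult F0 by (rule mult.commute)
    finally have "[:0, 1:] dvd c" by (subst (asm) dvd_mult_cancel_left) auto
    then show False using c(1) by (simp add: dvd_iff_poly_eq_0)
  qed
qed

section \<open>Finite fields and the q-power map\<close>

lemma prime_CHAR: "prime CHAR('a::{field,finite})"
  using finite_imp_CHAR_pos[OF finite[of "UNIV :: 'a set"]] by (auto intro: prime_CHAR_semidom)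

lemma power_CARD:
  fixes c :: "'a::{field,finite}"
  shows "c ^ CARD('a) = c"
proof (cases "c = 0")
  case False
  \<comment> \<open>Multiplication by c permutes the nonzero elements, so their product is
    unchanged.\<close>
  have "bij_betw ((*) c) (UNIV - {0}) (UNIV - {0})"
    using False by (intro bij_betwI[of _ _ _ "\<lambda>x. x / c"]) auto
  then have "(\<Prod>x\<in>UNIV - {0}. c * x) = \<Prod>(UNIV - {0})"
    using prod.reindex_bij_betw[of "(*) c" _ _ "\<lambda>x. x"] by blast
  then have "c ^ (CARD('a) - 1) * \<Prod>(UNIV - {0}) = \<Prod>(UNIV - {0})"
    by (simp add: prod.distrib)
  then have "c ^ (CARD('a) - 1) = 1" by simp
  then show ?thesis using power_minus_mult[of "CARD('a)" c] by simp
qed simp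

text \<open>The polynomial \<open>(X + 1)\<^sup>q - X\<^sup>q - 1\<close> has degree less than \<open>q\<close> and vanishes on all of \<open>F\<^sub>q\<close>.\<close>

lemma choose_CARD_eq_0:
  assumes "0 < k" "k < CARD('a::{field,finite})"
  shows "of_nat (CARD('a) choose k) = (0 :: 'a)"
proof -
  let ?q = "CARD('a)"
  define P where "P = (\<Sum>k\<in>{1..<?q}. monom (of_nat (?q choose k) :: 'a) k)"
  have q: "?q > 0" by simp
  have "poly P c = 0" for c
  proof -
    have "(c + 1) ^ ?q = (\<Sum>k\<le>?q. of_nat (?q choose k) * c ^ k)" by (simp add: binomial_ring)
    also have "{..?q} = insert 0 (insert ?q {1..<?q})" using q by auto
    also have "(\<Sum>k\<in>insert 0 (insert ?q {1..<?q}). of_nat (?q choose k) * c ^ k) = 1 + (c ^ ?q + poly P c)"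
      by (simp add: P_def poly_sum poly_monom)
    finally show ?thesis by (simp add: power_CARD)
  qed
  then have UNIV: "{x. poly P x = 0} = UNIV" by auto
  have deg: "degree P \<le> ?q - 1"
    unfolding P_def by (intro degree_sum_le) (auto intro: order.trans[OF degree_monom_le])
  have "P = 0"
  proof (rule ccontr)
    assume "P \<noteq> 0"
    then have "?q \<le> degree P" using card_poly_roots_bound[of P] unfolding UNIV by blast
    then show False using q deg by linarith
  qed
  moreover have "coeff P k = of_nat (?q choose k)" using assms by (simp add: P_def coeff_sum)
  ultimately show ?thesis by simp
qed

text \<open>Whether an integer vanishes in a ring depends only on the characteristic, so the middle
  binomial coefficients vanish here as they do in F_q.\<close>

lemma power_CARD_add:
  fixes x y :: "'b::comm_ring_1"
  assumes "CHAR('b) = CHAR('a::{field,finite})"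
  shows "(x + y) ^ CARD('a) = x ^ CARD('a) + y ^ CARD('a)"
proof -
  let ?q = "CARD('a)"
  have zero: "of_nat (?q choose k) = (0 :: 'b)" if "0 < k" "k < ?q" for k
    using choose_CARD_eq_0[OF that] assms by (simp add: of_nat_eq_0_iff_char_dvd)
  have "(x + y) ^ ?q = (\<Sum>k\<le>?q. of_nat (?q choose k) * x ^ k * y ^ (?q - k))" by (rule binomial_ring)
  also have "\<dots> = (\<Sum>k\<in>{0, ?q}. of_nat (?q choose k) * x ^ k * y ^ (?q - k))"
    by (intro sum.mono_neutral_right) (auto simp: zero)
  also have "\<dots> = x ^ ?q + y ^ ?q" by simp
  finally show ?thesis .
qed

lemma CHAR_Kbar: "CHAR('a::{field,finite} Kbar) = CHAR('a)"
proof -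
  have "CHAR('a poly fract) = CHAR('a poly)"
    by (rule CHAR_eqI) (auto simp: of_nat_eq_0_iff_char_dvd simp flip: to_fract.hom_of_nat)
  then show ?thesis by simp
qed

interpretation const_K: inj_idom_hom "const_K :: 'a::{field,finite} \<Rightarrow> 'a Kbar"
  by standard (auto simp: const_K_def one_pCons simp flip: to_fract.hom_add to_fract.hom_mult to_ac_add to_ac_mult)

lemma power_CARD_const_K: "const_K (c :: 'a::{field,finite}) ^ CARD('a) = const_K c"
  by (simp add: power_CARD flip: const_K.hom_power)

text \<open>X^q - X has at most q roots, and the q constants already are roots.\<close>

lemma power_CARD_fixed:
  fixes x :: "'a::{field,finite} Kbar"
  assumes "x ^ CARD('a) = x"
  shows "x \<in> range const_K"
proof (rule ccontr)
  assume x: "x \<notin> range const_K"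
  let ?q = "CARD('a)"
  let ?P = "monom 1 ?q - monom 1 1 :: 'a Kbar poly"
  have "card {0, 1 :: 'a} \<le> ?q" by (intro card_mono) auto
  then have q: "?q > 1" by simp
  then have "coeff ?P ?q = 1" by simp
  then have P: "?P \<noteq> 0" by (metis coeff_0 zero_neq_one)
  have "insert x (range const_K) \<subseteq> {y. poly ?P y = 0}"
    using assms by (auto simp: poly_monom power_CARD_const_K)
  then have "card (insert x (range (const_K :: 'a \<Rightarrow> _))) \<le> card {y. poly ?P y = 0}"
    by (intro card_mono poly_roots_finite P)
  also have "\<dots> \<le> degree ?P" by (rule card_poly_roots_bound[OF P])
  also have "\<dots> \<le> ?q" using q by (intro degree_diff_le degree_monom_le order.trans[OF degree_monom_le]) auto
  finally have "card (insert x (range (const_K :: 'a \<Rightarrow> _))) \<le> ?q" .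
  moreover have "card (range (const_K :: 'a \<Rightarrow> 'a Kbar)) = ?q" by (rule card_image[OF const_K.inj_f])
  ultimately show False using x by simp
qed

section \<open>Powers of units modulo a power of the variable\<close>

lemma fps_mod_X_power: "(f :: 'a::field fps) mod fps_X ^ N = fps_cutoff N f"
  by (simp add: fps_mod_def)

lemma mod_X_power_eq_iff:
  fixes f g :: "'a::field fps"
  shows "f mod fps_X ^ N = g mod fps_X ^ N \<longleftrightarrow> fps_X ^ N dvd f - g"
proof -
  have "f mod fps_X ^ N = g mod fps_X ^ N \<longleftrightarrow> fps_cutoff N (f - g) = 0"
    by (simp add: fps_mod_X_power fps_cutoff_diff)
  also have "\<dots> \<longleftrightarrow> fps_X ^ N dvd f - g"
    unfolding fps_cutoff_zero_iff by (cases "f - g = 0") (simp_all add: fps_dvd_iff)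
  finally show ?thesis .
qed

text \<open>A truncation corresponds to the tuple of its first M coefficients.\<close>

lemma finite_card_fps_cutoff:
  "finite (range (fps_cutoff M :: 'a::{field,finite} fps \<Rightarrow> 'a fps))"
  "card (range (fps_cutoff M :: 'a::{field,finite} fps \<Rightarrow> 'a fps)) = CARD('a) ^ M"
proof -
  let ?h = "\<lambda>f :: 'a fps. restrict (fps_nth f) {..<M}"
  have "bij_betw ?h (range (fps_cutoff M)) (PiE {..<M} (\<lambda>_. UNIV))"
  proof (rule bij_betw_imageI)
    show "inj_on ?h (range (fps_cutoff M))"
    proof (rule inj_onI, safe)
      fix f g :: "'a fps" assume "?h (fps_cutoff M f) = ?h (fps_cutoff M g)"
      then have "\<forall>i<M. fps_nth f i = fps_nth g i" by (auto simp: fun_eq_iff restrict_def split: if_splits)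
      then show "fps_cutoff M f = fps_cutoff M g" by (simp add: fps_cutoff_eq_fps_cutoff_iff)
    qed
    show "?h ` range (fps_cutoff M) = PiE {..<M} (\<lambda>_. UNIV)"
    proof safe
      fix g :: "nat \<Rightarrow> 'a" assume "g \<in> PiE {..<M} (\<lambda>_. UNIV)"
      then have "g = ?h (fps_cutoff M (Abs_fps g))"
        by (auto simp: fun_eq_iff restrict_def PiE_def extensional_def)
      then show "g \<in> ?h ` range (fps_cutoff M)" by blast
    qed (auto split: if_splits)
  qed
  moreover have "card (PiE {..<M} (\<lambda>_. UNIV :: 'a set)) = CARD('a) ^ M" by (simp add: card_PiE)
  moreover have "finite (PiE {..<M} (\<lambda>_. UNIV :: 'a set))" by (intro finite_PiE) auto
  ultimately show "finite (range (fps_cutoff M :: 'a fps \<Rightarrow> 'a fps))"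
    "card (range (fps_cutoff M :: 'a fps \<Rightarrow> 'a fps)) = CARD('a) ^ M"
    by (metis bij_betw_finite, metis bij_betw_same_card)
qed

lemma diff_power_dvd:
  fixes f g :: "'r::comm_ring_1"
  shows "f - g dvd f ^ n - g ^ n"
  by (simp add: power_diff_sumr2)

lemma power_p_diff:
  fixes f g :: "'a::field fps"
  assumes "prime CHAR('a)"
  shows "(f - g) ^ (CHAR('a) ^ e) = f ^ (CHAR('a) ^ e) - g ^ (CHAR('a) ^ e)"
proof -
  have "((f - g) + g) ^ (CHAR('a) ^ e) = (f - g) ^ (CHAR('a) ^ e) + g ^ (CHAR('a) ^ e)"
    by (rule freshmans_dream') (simp_all add: assms)
  then show ?thesis by simp
qed

text \<open>Here and below, the hypothesis relating \<open>N\<close>, \<open>k\<close> and \<open>M\<close> says that \<open>M\<close> is \<open>N / k\<close> rounded up.\<close>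

lemma X_power_dvd_power_iff:
  fixes f :: "'a::field fps"
  assumes "k > 0" "\<And>i. N \<le> k * i \<longleftrightarrow> M \<le> i"
  shows "fps_X ^ N dvd f ^ k \<longleftrightarrow> fps_X ^ M dvd f"
proof (cases "f = 0")
  case False
  then show ?thesis using assms(2)[of "subdegree f"] by (simp add: fps_dvd_iff)
qed (use assms(1) in \<open>simp add: power_0_left\<close>)

context
  fixes p e d' N M :: nat
  assumes p: "p = CHAR('a::{field,finite})" and d': "d' > 0" "coprime d' p"
    and M: "\<And>i. N \<le> p ^ e * i \<longleftrightarrow> M \<le> i"
begin

lemma prime_p: "prime p"
  unfolding p by (rule prime_CHAR)

text \<open>The difference on the left is the p^e-th power of u^d' - v^d', so its order in t is p^e
  times the order of the latter.\<close>

lemma power_mod_eq_iff: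
  fixes u v :: "'a fps"
  shows "u ^ (p ^ e * d') mod fps_X ^ N = v ^ (p ^ e * d') mod fps_X ^ N
    \<longleftrightarrow> fps_X ^ M dvd u ^ d' - v ^ d'"
proof -
  have "u ^ (p ^ e * d') - v ^ (p ^ e * d') = (u ^ d' - v ^ d') ^ (p ^ e)"
    using power_p_diff[where 'a = 'a, of "u ^ d'" "v ^ d'" e] prime_p unfolding p
    by (simp add: power_mult[symmetric] mult.commute)
  then show ?thesis
    using X_power_dvd_power_iff[of "p ^ e" N M] M prime_gt_0_nat[OF prime_p] by (simp add: mod_X_power_eq_iff)
qed

text \<open>The value depends only on u modulo t^M, which gives the upper bound. For the lower bound
  the map is injective on the q^(M-1) classes of 1-units modulo t^M, and \<open>U\<close> meets
  every class of units modulo t^N.\<close>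

lemma image_order_power:
  fixes U :: "'a fps set"
  assumes U: "\<And>v. fps_nth v 0 \<noteq> 0 \<Longrightarrow> \<exists>u\<in>U. u mod fps_X ^ N = v mod fps_X ^ N" and N: "N > 0"
  shows "CARD('a) ^ (M - 1) \<le> card ((\<lambda>u. u ^ (p ^ e * d') mod fps_X ^ N) ` U)"
    and "card ((\<lambda>u. u ^ (p ^ e * d') mod fps_X ^ N) ` U) \<le> CARD('a) ^ M"
proof -
  let ?f = "\<lambda>u :: 'a fps. u ^ (p ^ e * d') mod fps_X ^ N"
  have f_eq: "?f u = ?f v" if "fps_X ^ M dvd u - v" for u v
    using that diff_power_dvd[of u v d'] by (subst power_mod_eq_iff) (rule dvd_trans)
  have "?f ` U \<subseteq> ?f ` range (fps_cutoff M)"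
  proof safe
    fix u :: "'a fps"
    have "?f u = ?f (fps_cutoff M u)"
      by (rule f_eq) (simp add: mod_X_power_eq_iff[symmetric] fps_mod_X_power fps_eq_iff)
    then show "?f u \<in> ?f ` range (fps_cutoff M)" by blast
  qed
  then show upper: "card (?f ` U) \<le> CARD('a) ^ M"
    using surj_card_le[OF finite_card_fps_cutoff(1)] finite_card_fps_cutoff(2)[of M, where 'a = 'a] by metis
  have fin: "finite (?f ` U)"
    by (rule finite_subset[OF _ finite_card_fps_cutoff(1)[of N]]) (auto simp: fps_mod_X_power)
  \<comment> \<open>One representative for each class of 1-units modulo t^M.\<close>
  let ?W = "(\<lambda>w :: 'a fps. 1 + fps_X * w) ` range (fps_cutoff (M - 1))"
  have "M > 0" using M[of 0] N by (cases M) auto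
  have inj: "inj_on ?f ?W"
  proof (rule inj_onI)
    fix x y assume xy: "x \<in> ?W" "y \<in> ?W" "?f x = ?f y"
    then obtain a b :: "'a fps" where ab: "x = 1 + fps_X * fps_cutoff (M - 1) a" "y = 1 + fps_X * fps_cutoff (M - 1) b" by blast
    \<comment> \<open>The cofactor of x - y in x^d' - y^d'. Both x and y have constant term 1, so s
      has constant term d', which is nonzero because d' is prime to p.\<close>
    define s where "s = (\<Sum>i<d'. y ^ (d' - Suc i) * x ^ i)"
    have "x ^ d' - y ^ d' = (x - y) * s" unfolding s_def by (rule power_diff_sumr2)
    moreover have "fps_X ^ M dvd x ^ d' - y ^ d'" using xy(3) power_mod_eq_iff by blast
    moreover have "fps_nth s 0 = of_nat d'" by (simp add: s_def fps_sum_nth ab fps_nth_power_0)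
    then have "is_unit s"
      using d' prime_p by (auto simp: fps_is_unit_iff of_nat_eq_0_iff_char_dvd p[symmetric] coprime_absorb_right prime_nat_iff)
    ultimately have "fps_X ^ M dvd x - y" by (simp add: dvd_mult_unit_iff)
    also have "x - y = fps_X * fps_cutoff (M - 1) (a - b)" by (simp add: ab fps_cutoff_diff algebra_simps)
    also have "fps_X ^ M = fps_X * (fps_X ^ (M - 1) :: 'a fps)" using \<open>M > 0\<close> by (cases M) auto
    finally have "fps_X ^ (M - 1) dvd fps_cutoff (M - 1) (a - b)" by simp
    then have "fps_X ^ (M - 1) dvd fps_cutoff (M - 1) (a - b) - 0" by simp
    then have "fps_cutoff (M - 1) (a - b) = 0"
      unfolding mod_X_power_eq_iff[symmetric] fps_mod_X_power
      by (metis fps_cutoff_eq_fps_cutoff_iff fps_cutoff_nth fps_cutoff_zero)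
    then show "x = y" by (simp add: ab fps_cutoff_diff)
  qed
  have "?f ` ?W \<subseteq> ?f ` U"
  proof (rule image_subsetI)
    fix x assume "x \<in> ?W"
    then have "fps_nth x 0 \<noteq> 0" by auto
    then obtain u where u: "u \<in> U" "u mod fps_X ^ N = x mod fps_X ^ N" using U by blast
    have "fps_X ^ N dvd u ^ (p ^ e * d') - x ^ (p ^ e * d')"
      using u(2) diff_power_dvd[of u x] dvd_trans unfolding mod_X_power_eq_iff by blast
    then have "?f u = ?f x" unfolding mod_X_power_eq_iff .
    then show "?f x \<in> ?f ` U" using u(1) by (metis imageI)
  qed
  then have "card (?f ` ?W) \<le> card (?f ` U)" by (rule card_mono[OF fin])
  moreover have "card (?f ` ?W) = card ?W" by (rule card_image[OF inj])
  moreover have "card ?W = card (range (fps_cutoff (M - 1) :: 'a fps \<Rightarrow> 'a fps))"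
    by (rule card_image) (auto intro!: inj_onI)
  ultimately show "CARD('a) ^ (M - 1) \<le> card (?f ` U)" using finite_card_fps_cutoff(2)[of "M - 1", where 'a = 'a] by metis
qed

end

text \<open>The logarithm lies between M - 1 and M, where M is N / k rounded up, so the quotient by
  N is squeezed to 1 / k. The factor 1 is the dimension of the Zariski closure.\<close>

lemma limsup_log_card:
  fixes D :: "nat \<Rightarrow> nat"
  assumes q: "q > 1" and k: "k > 0"
    and lower: "\<And>N M. N > 0 \<Longrightarrow> (\<And>i. N \<le> k * i \<longleftrightarrow> M \<le> i) \<Longrightarrow> q ^ (M - 1) \<le> D N"
    and upper: "\<And>N M. N > 0 \<Longrightarrow> (\<And>i. N \<le> k * i \<longleftrightarrow> M \<le> i) \<Longrightarrow> D N \<le> q ^ M"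
  shows "limsup (\<lambda>N. ereal (log (real q) (real (D N))) / (ereal (real N) * 1)) = ereal (1 / real k)"
proof -
  define M where "M N = (N + k - 1) div k" for N
  have M: "N \<le> k * i \<longleftrightarrow> M N \<le> i" for N i
  proof -
    have "M N \<le> i \<longleftrightarrow> N + k - 1 < Suc i * k"
      unfolding M_def using k less_mult_imp_div_less div_less_iff_less_mult[OF k] by (metis less_Suc_eq_le)
    also have "\<dots> \<longleftrightarrow> N \<le> k * i" using k by (auto simp: mult.commute)
    finally show ?thesis by simp
  qed
  have bound: "(real N / real k - 1) / real N \<le> log q (D N) / real N"
    "log q (D N) / real N \<le> (real N / real k + 1) / real N" if N: "N > 0" for N
  proof -
    have D: "q ^ (M N - 1) \<le> D N" "D N \<le> q ^ M N" using lower upper N M by blast+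
    have Dpos: "D N > 0" using D(1) q by (metis gr0I le_zero_eq less_nat_zero_code power_not_zero zero_less_one)
    have "real (M N - 1) = log q (real (q ^ (M N - 1)))" using q by (simp add: log_nat_power)
    also have "\<dots> \<le> log q (D N)" using q D Dpos by (subst log_le_cancel_iff) (auto simp del: of_nat_power)
    finally have 1: "real (M N - 1) \<le> log q (D N)" .
    have "log q (D N) \<le> log q (real (q ^ M N))" using q D Dpos by (subst log_le_cancel_iff) (auto simp del: of_nat_power)
    also have "\<dots> = real (M N)" using q by (simp add: log_nat_power)
    finally have 2: "log q (D N) \<le> real (M N)" .
    have "N \<le> k * M N" using M by blast
    then have 3: "real N / real k \<le> real (M N)" using k
      by (simp add: divide_le_eq mult.commute flip: of_nat_mult)
    have "\<not> N \<le> k * (M N - 1)" using M[of N "M N - 1"] M[of N 0] N by auto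
    then have "k * (M N - 1) \<le> N" by simp
    then have 4: "real (M N - 1) \<le> real N / real k" using k
      by (simp add: le_divide_eq mult.commute flip: of_nat_mult)
    have "M N > 0" using M[of N 0] N by auto
    then have "real (M N - 1) = real (M N) - 1" by simp
    then show "(real N / real k - 1) / real N \<le> log q (D N) / real N"
      "log q (D N) / real N \<le> (real N / real k + 1) / real N"
      using 1 2 3 4 N by (auto intro!: divide_right_mono)
  qed
  have "(\<lambda>N. log q (D N) / real N) \<longlonglongrightarrow> 1 / real k"
  proof (rule real_tendsto_sandwich)
    show "(\<lambda>N. (real N / real k - 1) / real N) \<longlonglongrightarrow> 1 / real k"
      "(\<lambda>N. (real N / real k + 1) / real N) \<longlonglongrightarrow> 1 / real k"
      unfolding inverse_eq_divide[symmetric] using k by real_asymp+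
  qed (use bound in \<open>auto intro: eventually_sequentiallyI[of 1]\<close>)
  then have "(\<lambda>N. ereal (log q (D N) / real N)) \<longlonglongrightarrow> ereal (1 / real k)" by simp
  \<comment> \<open>The extended quotient agrees with the real one from N = 1 on.\<close>
  then have "(\<lambda>N. ereal (log q (D N)) / (ereal (real N) * 1)) \<longlonglongrightarrow> ereal (1 / real k)"
    by (rule Lim_transform_eventually) (rule eventually_sequentiallyI[of 1], simp)
  then show ?thesis by (intro lim_imp_Limsup) simp_all
qed

section \<open>Zariski closures in the multiplicative group\<close>

lemma infinite_alg_closed: "infinite (UNIV :: 'c::alg_closed_field set)"
proof
  assume fin: "finite (UNIV :: 'c set)"
  \<comment> \<open>Over a finite field this nonconstant polynomial takes the value 1
    everywhere.\<close>
  let ?P = "(\<Prod>x\<in>UNIV. [:- x, 1:]) + 1 :: 'c poly"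
  have "poly (\<Prod>x\<in>UNIV. [:- x, 1:]) y = 0" for y :: 'c
    using fin by (auto simp: poly_prod prod_zero_iff)
  then have 1: "poly ?P y = 1" for y by simp
  have "degree (\<Prod>x\<in>UNIV. [:- x, 1 :: 'c:]) = CARD('c)"
    by (subst degree_prod_eq_sum_degree) auto
  moreover have "CARD('c) > 0" using fin by (simp add: card_gt_0_iff)
  ultimately have "degree ?P > 0" by (subst degree_add_eq_left) auto
  then show False using alg_closed_imp_poly_has_root[of ?P] 1 by auto
qed

lemma topspace_zariski_GL1: "topspace (zariski_GL1 :: 'b::field topology) = - {0}"
proof -
  have "openin (zariski_GL1 :: 'b topology) (- {0})"
    unfolding openin_zariski_GL1 by (intro exI[of _ "{1}"]) auto
  moreover have "U \<subseteq> - {0}" if "openin (zariski_GL1 :: 'b topology) U" for U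
    using that unfolding openin_zariski_GL1 by auto
  ultimately show ?thesis unfolding topspace_def by blast
qed

text \<open>A closed set cut out by some nonzero polynomial is contained in its finite root
  set.\<close>

lemma closedin_zariski_GL1_cases:
  fixes C :: "'b::field set"
  assumes "closedin zariski_GL1 C"
  shows "C = - {0} \<or> finite C"
proof -
  obtain P :: "'b poly set" where P: "- {0} - C = {x. x \<noteq> 0 \<and> \<not> (\<forall>f\<in>P. poly f x = 0)}" and sub: "C \<subseteq> - {0}"
    using assms unfolding closedin_def topspace_zariski_GL1 openin_zariski_GL1 by auto
  have C: "C = {x. x \<noteq> 0 \<and> (\<forall>f\<in>P. poly f x = 0)}" using P sub by auto
  show ?thesis
  proof (cases "P \<subseteq> {0}")
    case True then show ?thesis using C by auto
  next
    case False
    then obtain f where "f \<in> P" "f \<noteq> 0" by auto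
    then have "C \<subseteq> {x. poly f x = 0}" "finite {x. poly f x = 0}" using C poly_roots_finite by auto
    then show ?thesis by (auto intro: finite_subset)
  qed
qed

lemma closedin_zariski_GL1_finite:
  fixes C :: "'b::field set"
  assumes "finite C" "C \<subseteq> - {0}"
  shows "closedin zariski_GL1 C"
proof -
  have "- {0} - C = {x. x \<noteq> 0 \<and> \<not> (\<forall>f\<in>{\<Prod>c\<in>C. [:- c, 1:]}. poly f x = 0)}"
    using assms(1) by (auto simp: poly_prod prod_zero_iff)
  then have "openin zariski_GL1 (- {0} - C)" unfolding openin_zariski_GL1 by blast
  then show ?thesis using assms(2) by (simp add: closedin_def topspace_zariski_GL1)
qed

text \<open>The closure is an infinite closed set, and only the whole group is one.\<close>

lemma closure_of_infinite_zariski_GL1: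
  fixes S :: "'b::field set"
  assumes "infinite S" "S \<subseteq> - {0}"
  shows "zariski_GL1 closure_of S = - {0}"
proof -
  have "S \<subseteq> zariski_GL1 closure_of S" by (rule closure_of_subset) (use assms topspace_zariski_GL1 in blast)
  then have "infinite (zariski_GL1 closure_of S)" using assms(1) finite_subset by blast
  then show ?thesis using closedin_zariski_GL1_cases[OF closedin_closure_of] by blast
qed

lemma closedin_zariski_GL1_subset:
  "closedin zariski_GL1 C \<Longrightarrow> C \<subseteq> - {0 :: 'b::field}"
  using closedin_subset[of zariski_GL1 C] unfolding topspace_zariski_GL1 .

lemma irreducible_zariski_GL1_cases:
  fixes C :: "'b::field set"
  assumes "irreducible_closedin zariski_GL1 C"
  shows "C = - {0} \<or> (\<exists>x. C = {x})"
proof (cases "C = - {0}")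
  case False
  then have fin: "finite C" using assms closedin_zariski_GL1_cases unfolding irreducible_closedin_def by blast
  obtain x where x: "x \<in> C" using assms unfolding irreducible_closedin_def by blast
  have sub: "C \<subseteq> - {0}" using assms closedin_zariski_GL1_subset unfolding irreducible_closedin_def by blast
  \<comment> \<open>A finite irreducible set cannot be split into one point and the rest unless it
    is that point.\<close>
  have "closedin zariski_GL1 {x}" "closedin zariski_GL1 (C - {x})"
    using fin sub x by (auto intro!: closedin_zariski_GL1_finite)
  moreover have "C = {x} \<union> (C - {x})" using x by auto
  ultimately have "C = {x} \<or> C = C - {x}" using assms unfolding irreducible_closedin_def by blast
  then show ?thesis using x by blast
qed simp

lemma krull_dim_zariski_GL1:
  assumes inf: "infinite (UNIV :: 'b::field set)"
  shows "krull_dim (zariski_GL1 :: 'b topology) = 1"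
proof -
  let ?I = "irreducible_closedin (zariski_GL1 :: 'b topology)"
  have inf': "infinite (- {0 :: 'b})" using inf by (simp add: Compl_eq_Diff_UNIV)
  have "closedin zariski_GL1 {1 :: 'b}" by (intro closedin_zariski_GL1_finite) auto
  then have I1: "?I {1}" unfolding irreducible_closedin_def by blast
  have I2: "?I (- {0})" unfolding irreducible_closedin_def
  proof (intro conjI allI impI)
    show "closedin zariski_GL1 (- {0 :: 'b})" using closedin_topspace[of zariski_GL1] by (simp add: topspace_zariski_GL1)
    show "- {0 :: 'b} \<noteq> {}" using inf' by (metis finite.emptyI)
    fix A B :: "'b set" assume "closedin zariski_GL1 A \<and> closedin zariski_GL1 B \<and> - {0} = A \<union> B"
    then show "- {0} = A \<or> - {0} = B" using inf' closedin_zariski_GL1_cases by (metis finite_Un)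
  qed
  let ?S = "{enat n |n. \<exists>C. (\<forall>i\<le>n. ?I (C i)) \<and> (\<forall>i<n. C i \<subset> C (Suc i))}"
  have "1 \<in> ?S"
  proof -
    have "{1} \<subset> - {0 :: 'b}" using inf' by (metis Compl_iff finite.emptyI finite_insert insert_iff psubsetI singletonD subsetI zero_neq_one)
    then have "\<exists>C. (\<forall>i\<le>1. ?I (C i)) \<and> (\<forall>i<1. C i \<subset> C (Suc i))"
      using I1 I2 by (intro exI[of _ "\<lambda>i. if i = 0 then {1} else - {0}"]) auto
    then show ?thesis unfolding one_enat_def by blast
  qed
  moreover have "x \<le> 1" if "x \<in> ?S" for x
  proof -
    obtain n C where n: "x = enat n" "\<forall>i\<le>n. ?I (C i)" "\<forall>i<n. C i \<subset> C (Suc i)" using \<open>x \<in> ?S\<close> by blast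
    have "n \<le> 1"
    proof (rule ccontr)
      assume "\<not> n \<le> 1"
      \<comment> \<open>In a chain of length 2 the middle set is proper, hence a point, and the
        bottom one would be empty.\<close>
      then have I: "?I (C 0)" "?I (C 1)" "?I (C 2)" and sub: "C 0 \<subset> C 1" "C 1 \<subset> C 2"
        using n(2,3) by (auto simp: numeral_2_eq_2)
      have "C 2 \<subseteq> - {0}" using I(3) closedin_zariski_GL1_subset unfolding irreducible_closedin_def by blast
      then have "C 1 \<noteq> - {0}" using sub(2) by auto
      then obtain y where "C 1 = {y}" using irreducible_zariski_GL1_cases[OF I(2)] by blast
      then have "C 0 = {}" using sub(1) by auto
      then show False using I(1) unfolding irreducible_closedin_def by simp
    qed
    then show ?thesis using n(1) by (simp add: one_enat_def)
  qed
  ultimately have "Sup ?S = 1" by (intro antisym Sup_least Sup_upper)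
  then show ?thesis unfolding krull_dim_def .
qed

lemma hull_dim_eq_1:
  fixes I :: "'a::field fps set"
  assumes "infinite I" "0 \<notin> I"
  shows "hull_dim I = 1"
proof -
  let ?S = "(\<lambda>u. to_ac (fps_to_fls u)) ` I"
  have "inj_on (\<lambda>u. to_ac (fps_to_fls u)) I" by (auto intro!: inj_onI)
  then have "infinite ?S" using assms(1) finite_image_iff by blast
  moreover have "?S \<subseteq> - {0}" using assms(2) by auto
  ultimately have "zariski_hull I = - {0}"
    unfolding zariski_hull_def by (rule closure_of_infinite_zariski_GL1)
  then show ?thesis
    unfolding hull_dim_def using krull_dim_zariski_GL1[OF infinite_alg_closed[where 'c = "'a fls alg_closure"]]
    by (metis subtopology_topspace topspace_zariski_GL1)
qed

section \<open>Torsion of the Carlitz module\<close>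

lemma q_gt_1: "CARD('a::{field,finite}) > 1"
proof -
  have "card {0, 1 :: 'a} \<le> CARD('a)" by (intro card_mono) auto
  then show ?thesis by simp
qed

section \<open>The separable closure of K and its automorphisms\<close>

lemma prime_CHAR_K: "prime CHAR('a::{field,finite} K)"
proof -
  have "CHAR('a K) = CHAR('a Kbar)" by simp
  also have "\<dots> = CHAR('a)" by (rule CHAR_Kbar)
  finally show ?thesis using prime_CHAR[where 'a = 'a] by simp
qed

lemma Ksep_iff: "x \<in> Ksep \<longleftrightarrow> separable x"
  by (simp add: Ksep_def separable_def)

lemma Ksep_add: "x \<in> Ksep \<Longrightarrow> y \<in> Ksep \<Longrightarrow> x + y \<in> Ksep"
  and Ksep_mult: "x \<in> Ksep \<Longrightarrow> y \<in> Ksep \<Longrightarrow> x * y \<in> Ksep"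
  and Ksep_to_ac: "to_ac c \<in> Ksep"
  unfolding Ksep_iff
  by (rule separable_add[OF prime_CHAR_K] separable_mult[OF prime_CHAR_K] separable_to_ac[OF prime_CHAR_K]; assumption?)+

lemma Ksep_0: "0 \<in> Ksep" and Ksep_1: "1 \<in> Ksep"
  using Ksep_to_ac[of 0] Ksep_to_ac[of 1] by simp_all

lemma Ksep_sum: "(\<And>i. i \<in> I \<Longrightarrow> f i \<in> Ksep) \<Longrightarrow> (\<Sum>i\<in>I. f i) \<in> Ksep"
  by (induction I rule: infinite_finite_induct) (auto intro: Ksep_add Ksep_0)

lemma Ksep_power: "x \<in> Ksep \<Longrightarrow> x ^ n \<in> Ksep"
  by (induction n) (simp_all add: Ksep_1 Ksep_mult)

text \<open>Surjectivity on \<open>Ksep\<close> holds because h maps the finite root set of each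
  polynomial over K injectively into itself, hence permutes it.\<close>

lemma restrict_hom_in_Gal:
  fixes h :: "'a::{field,finite} Kbar \<Rightarrow> 'a Kbar"
  assumes add: "\<And>x y. h (x + y) = h x + h y" and mult: "\<And>x y. h (x * y) = h x * h y"
    and const: "\<And>c. h (to_ac c) = to_ac c" and inj: "inj h"
  shows "restrict h Ksep \<in> Gal"
proof -
  have h0: "h 0 = 0" using const[of 0] by simp
  have eval: "poly (map_poly to_ac f) (h x) = h (poly (map_poly to_ac f) x)" for f :: "'a K poly" and x
    by (induction f) (simp_all add: hom_distribs add mult const h0)
  have maps: "h x \<in> Ksep" if "x \<in> Ksep" for x
  proof -
    from that obtain f :: "'a K poly" where "irreducible f" "poly (map_poly to_ac f) x = 0"
      "rsquarefree (map_poly to_ac f)" unfolding Ksep_def by blast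
    then show ?thesis unfolding Ksep_def by (auto simp: eval h0 intro!: exI[of _ f])
  qed
  have surj: "y \<in> h ` Ksep" if "y \<in> Ksep" for y
  proof -
    from that obtain f :: "'a K poly" where f: "irreducible f" "poly (map_poly to_ac f) y = 0"
      "rsquarefree (map_poly to_ac f)" unfolding Ksep_def by blast
    let ?R = "{x. poly (map_poly to_ac f) x = 0}"
    have "finite ?R" using f(3) by (intro poly_roots_finite) (simp add: rsquarefree_def)
    moreover have "h ` ?R \<subseteq> ?R" by (auto simp: eval h0)
    ultimately have "h ` ?R = ?R" using inj by (intro endo_inj_surj) (auto intro: inj_on_subset)
    moreover have "?R \<subseteq> Ksep" using f unfolding Ksep_def by blast
    ultimately show ?thesis using f(2) by blast
  qed
  have bij: "bij_betw (restrict h Ksep) Ksep Ksep"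
    unfolding bij_betw_restrict_eq using inj maps surj by (auto simp: bij_betw_def intro: inj_on_subset)
  have "restrict h Ksep (x + y) = restrict h Ksep x + restrict h Ksep y
      \<and> restrict h Ksep (x * y) = restrict h Ksep x * restrict h Ksep y"
    if "x \<in> Ksep" "y \<in> Ksep" for x y
    using that Ksep_add[OF that] Ksep_mult[OF that] by (simp add: add mult)
  moreover have "restrict h Ksep (to_ac c) = to_ac c" for c
    using Ksep_to_ac[of c] by (simp add: const)
  ultimately show ?thesis unfolding Gal_def using bij by blast
qed

section \<open>Cyclotomic polynomials of the Carlitz module\<close>

text \<open>The coefficients live in \<open>F\<^sub>q[\<theta>]\<close>, with \<open>\<theta> = [:0, 1:]\<close>; \<open>carlitz_poly n\<close> is the action of \<open>t\<^sup>n\<close>, and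
  the roots of \<open>carlitz_cyclotomic n\<close> are the torsion points of exact order \<open>t\<close> to the power \<open>n + 1\<close>.\<close>

primrec carlitz_poly :: "nat \<Rightarrow> 'a::{field,finite} poly poly" where
  "carlitz_poly 0 = [:0, 1:]"
| "carlitz_poly (Suc n) = carlitz_poly n ^ CARD('a) + smult [:0, 1:] (carlitz_poly n)"

definition carlitz_cyclotomic :: "nat \<Rightarrow> 'a::{field,finite} poly poly" where
  "carlitz_cyclotomic n = carlitz_poly n ^ (CARD('a) - 1) + [:[:0, 1:]:]"

lemma carlitz_poly_Suc:
  "carlitz_poly (Suc n) = carlitz_poly n * (carlitz_cyclotomic n :: 'a::{field,finite} poly poly)"
proof -
  have "carlitz_poly n * carlitz_poly n ^ (CARD('a) - 1) = (carlitz_poly n :: 'a poly poly) ^ CARD('a)"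
    using q_gt_1[where 'a = 'a] power_minus_mult[of "CARD('a)" "carlitz_poly n :: 'a poly poly"] by (simp add: mult.commute)
  then show ?thesis by (simp add: carlitz_cyclotomic_def algebra_simps)
qed

lemma degree_carlitz_poly: "degree (carlitz_poly n :: 'a::{field,finite} poly poly) = CARD('a) ^ n"
proof (induction n)
  case (Suc n)
  have nz: "(carlitz_poly n :: 'a poly poly) \<noteq> 0" using Suc by (auto simp: power_eq_0_iff dest: sym)
  have "degree ((carlitz_poly n :: 'a poly poly) ^ CARD('a)) = CARD('a) * CARD('a) ^ n"
    using nz Suc by (simp add: degree_power_eq)
  moreover have "CARD('a) ^ n < CARD('a) * CARD('a) ^ n" using q_gt_1[where 'a = 'a] by simp
  ultimately show ?case using Suc by (simp add: degree_add_eq_left)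
qed simp

text \<open>Modulo theta, the action of t is the q-power map.\<close>

lemma carlitz_poly_at_0: "map_poly (\<lambda>p. poly p 0) (carlitz_poly n :: 'a::{field,finite} poly poly) = monom 1 (CARD('a) ^ n)"
proof (induction n)
  case 0
  show ?case by (simp add: map_poly_pCons monom_altdef)
next
  case (Suc n)
  then show ?case
    by (simp add: map_poly_at_0.hom_add map_poly_at_0.hom_power map_poly_smult monom_power mult.commute)
qed

lemma coeff_0_carlitz_poly: "coeff (carlitz_poly n :: 'a::{field,finite} poly poly) 0 = 0"
  by (induction n) (simp_all add: coeff_0_power)

lemma degree_carlitz_cyclotomic:
  "degree (carlitz_cyclotomic n :: 'a::{field,finite} poly poly) = CARD('a) ^ n * (CARD('a) - 1)"
proof -
  have "(carlitz_poly n :: 'a poly poly) \<noteq> 0"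
    using degree_carlitz_poly[of n, where 'a = 'a] by (auto dest: sym)
  then have "degree (carlitz_poly n ^ (CARD('a) - 1) :: 'a poly poly) = CARD('a) ^ n * (CARD('a) - 1)"
    by (simp add: degree_power_eq degree_carlitz_poly)
  moreover have "CARD('a) ^ n * (CARD('a) - 1) > 0" using q_gt_1[where 'a = 'a] by simp
  ultimately show ?thesis unfolding carlitz_cyclotomic_def by (simp add: degree_add_eq_left)
qed

text \<open>The polynomial reduces to a power of X modulo theta and has constant term theta.\<close>

lemma irreducible_carlitz_cyclotomic:
  "irreducible (map_poly to_fract (carlitz_cyclotomic n :: 'a::{field,finite} poly poly))"
proof (rule Eisenstein_at_0)
  have q: "CARD('a) - 1 > 0" using q_gt_1[where 'a = 'a] by simp
  show "degree (carlitz_cyclotomic n :: 'a poly poly) > 0" using q by (simp add: degree_carlitz_cyclotomic)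
  show "coeff (carlitz_cyclotomic n :: 'a poly poly) 0 = [:0, 1:]"
    using q by (simp add: carlitz_cyclotomic_def coeff_0_power coeff_0_carlitz_poly)
  show "map_poly (\<lambda>p. poly p 0) (carlitz_cyclotomic n) = monom (1::'a) (degree (carlitz_cyclotomic n :: 'a poly poly))"
    unfolding degree_carlitz_cyclotomic unfolding carlitz_cyclotomic_def
    by (simp add: map_poly_at_0.hom_add map_poly_at_0.hom_power carlitz_poly_at_0 monom_power map_poly_pCons)
qed

lemma of_nat_CARD: "of_nat CARD('a::{field,finite}) = (0 :: 'a)"
  using choose_CARD_eq_0[of 1, where 'a = 'a] q_gt_1[where 'a = 'a] by simp

lemma pderiv_carlitz_poly: "pderiv (carlitz_poly n :: 'a::{field,finite} poly poly) = [:[:0, 1:] ^ n:]"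
proof (induction n)
  case (Suc n)
  have "of_nat CARD('a) = (0 :: 'a poly)" using of_nat_CARD[where 'a = 'a] by (simp add: of_nat_poly)
  then show ?case using Suc by (simp add: pderiv_add pderiv_power pderiv_smult)
qed (simp add: pderiv_pCons)

text \<open>If the derivative vanished, differentiating \<open>carlitz_poly_Suc\<close> would make
  the constant theta^(n+1) a multiple of a polynomial of positive degree in X.\<close>

lemma pderiv_carlitz_cyclotomic: "pderiv (carlitz_cyclotomic n :: 'a::{field,finite} poly poly) \<noteq> 0"
proof
  assume "pderiv (carlitz_cyclotomic n :: 'a poly poly) = 0"
  then have "[:[:0, 1::'a:] ^ Suc n:] = carlitz_cyclotomic n * [:[:0, 1:] ^ n:]"
    unfolding pderiv_carlitz_poly[symmetric] carlitz_poly_Suc by (simp add: pderiv_mult)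
  then have "degree [:[:0, 1::'a:] ^ Suc n:] = degree (carlitz_cyclotomic n * [:[:0, 1::'a:] ^ n:])" by simp
  then have "degree (carlitz_cyclotomic n :: 'a poly poly) = 0" by simp
  then show False using q_gt_1[where 'a = 'a] by (simp add: degree_carlitz_cyclotomic)
qed

definition carlitz_1 :: "'a::{field,finite} Kbar \<Rightarrow> 'a Kbar" where
  "carlitz_1 x = x ^ CARD('a) + theta * x"

lemma eval_carlitz_poly:
  "poly (map_poly to_ac (map_poly to_fract (carlitz_poly n))) x = (carlitz_1 ^^ n) (x :: 'a::{field,finite} Kbar)"
  by (induction n) (simp_all add: hom_distribs carlitz_1_def theta_def)

text \<open>By \<open>carlitz_poly_Suc\<close>, the value at w n times w 0 is the action of t^(n+1)
  on w n, which is 0, and w 0 is nonzero.\<close>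

lemma torsion_point_root:
  fixes w :: "nat \<Rightarrow> 'a::{field,finite} Kbar"
  assumes w0: "carlitz_1 (w 0) = 0" "w 0 \<noteq> 0" and w: "\<And>n. carlitz_1 (w (Suc n)) = w n"
  shows "poly (map_poly to_ac (map_poly to_fract (carlitz_cyclotomic n))) (w n) = 0"
proof -
  have iter: "(carlitz_1 ^^ i) (w (i + k)) = w k" for i k
    by (induction i) (simp_all add: funpow_swap1 w)
  have "w 0 * poly (map_poly to_ac (map_poly to_fract (carlitz_cyclotomic n))) (w n)
      = poly (map_poly to_ac (map_poly to_fract (carlitz_poly (Suc n)))) (w n)"
    using iter[of n 0] by (simp add: carlitz_poly_Suc hom_distribs eval_carlitz_poly del: carlitz_poly.simps)
  also have "\<dots> = carlitz_1 (w 0)" using iter[of n 0] by (simp add: eval_carlitz_poly del: carlitz_poly.simps)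
  finally show ?thesis using w0 by simp
qed

lemma torsion_point_in_Ksep:
  fixes w :: "nat \<Rightarrow> 'a::{field,finite} Kbar"
  assumes "carlitz_1 (w 0) = 0" "w 0 \<noteq> 0" "\<And>n. carlitz_1 (w (Suc n)) = w n"
  shows "w n \<in> Ksep"
proof -
  have "pderiv (map_poly to_fract (carlitz_cyclotomic n :: 'a poly poly)) \<noteq> 0"
    using pderiv_carlitz_cyclotomic[of n] by (simp flip: to_fract.map_poly_pderiv)
  from rsquarefree_if_pderiv[OF irreducible_carlitz_cyclotomic this]
  show ?thesis unfolding Ksep_def
    using irreducible_carlitz_cyclotomic torsion_point_root[OF assms] by blast
qed

section \<open>Frobenius on coefficients and its eigenvectors\<close>

definition frob :: "'a::{field,finite} Kbar fps \<Rightarrow> 'a Kbar fps" where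
  "frob f = Abs_fps (\<lambda>n. fps_nth f n ^ CARD('a))"

lemma fps_nth_frob [simp]: "fps_nth (frob f) n = fps_nth (f :: 'a::{field,finite} Kbar fps) n ^ CARD('a)"
  by (simp add: frob_def)

lemma power_CARD_sum:
  fixes f :: "'i \<Rightarrow> 'a::{field,finite} Kbar"
  shows "(\<Sum>i\<in>I. f i) ^ CARD('a) = (\<Sum>i\<in>I. f i ^ CARD('a))"
  by (induction I rule: infinite_finite_induct) (simp_all add: power_CARD_add[OF CHAR_Kbar])

lemma frob_mult: "frob (f * g) = frob f * frob g"
  by (rule fps_ext) (simp add: fps_mult_nth power_CARD_sum power_mult_distrib)

lemma frob_1: "frob 1 = 1"
  by (rule fps_ext) (simp add: fps_one_nth)

lemma frob_power: "frob (f ^ n) = frob f ^ n"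
  by (induction n) (simp_all add: frob_1 frob_mult)

definition lift_fps :: "'a::{field,finite} fps \<Rightarrow> 'a Kbar fps" where
  "lift_fps v = Abs_fps (\<lambda>n. const_K (fps_nth v n))"

lemma fps_nth_lift [simp]: "fps_nth (lift_fps v) n = const_K (fps_nth v n)"
  by (simp add: lift_fps_def)

lemma lift_fps_mult: "lift_fps (u * v) = lift_fps u * lift_fps v"
  by (rule fps_ext) (simp add: fps_mult_nth const_K.hom_sum const_K.hom_mult)

lemma lift_fps_power: "lift_fps (u ^ n) = lift_fps u ^ n"
proof (induction n)
  case 0
  show ?case by (rule fps_ext) (simp add: fps_one_nth)
qed (simp add: lift_fps_mult)

lemma lift_fps_inject: "lift_fps u = lift_fps v \<Longrightarrow> u = v"
  by (simp add: fps_eq_iff)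

lemma frob_lift: "frob (lift_fps v) = lift_fps v"
  by (rule fps_ext) (simp add: power_CARD_const_K)

lemma frob_fixed: assumes "frob v = v" obtains u where "v = lift_fps u"
proof -
  have "\<exists>c. fps_nth v n = const_K c" for n
    using power_CARD_fixed[of "fps_nth v n"] arg_cong[OF assms, of "\<lambda>f. fps_nth f n"] by auto
  then obtain c where "\<And>n. fps_nth v n = const_K (c n)" by metis
  then have "v = lift_fps (Abs_fps c)" by (intro fps_ext) simp
  then show ?thesis by (rule that)
qed

definition t_minus_theta :: "'a::{field,finite} Kbar fps" where
  "t_minus_theta = fps_X - fps_const theta"

lemma t_minus_theta_nonzero: "t_minus_theta \<noteq> 0"
proof
  assume "t_minus_theta = (0 :: 'a Kbar fps)"
  from arg_cong[OF this, of "\<lambda>f. fps_nth f 1"] show False by (simp add: t_minus_theta_def)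
qed

lemma fps_nth_t_minus_theta_mult:
  "fps_nth (t_minus_theta * f) n = (if n = 0 then 0 else fps_nth f (n - 1)) - theta * fps_nth f n"
  by (simp add: t_minus_theta_def left_diff_distrib)

text \<open>Since w is invertible, f / w is a power series; it is fixed by \<open>frob\<close>, so
  its coefficients lie in F_q.\<close>

lemma frob_eigen_unique:
  assumes w: "frob w = t_minus_theta ^ d * w" "fps_nth w 0 \<noteq> 0" and f: "frob f = t_minus_theta ^ d * f"
  obtains v where "f = lift_fps v * w"
proof -
  define v where "v = f * inverse w"
  have "inverse w * w = 1" using w(2) by (rule inverse_mult_eq_1)
  then have fv: "f = v * w" by (simp add: v_def mult.assoc)
  have "w \<noteq> 0" using w(2) by auto
  have "frob v * (t_minus_theta ^ d * w) = v * (t_minus_theta ^ d * w)"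
    using f unfolding fv frob_mult w(1) by (simp only: mult_ac)
  then have "frob v = v" using \<open>w \<noteq> 0\<close> t_minus_theta_nonzero by auto
  then show ?thesis using frob_fixed fv that by metis
qed

text \<open>Comparing coefficients shows that the solutions are the compatible systems of t-power
  torsion points of the Carlitz module.\<close>

lemma frob_eigen_1_iff:
  "frob f = t_minus_theta * f \<longleftrightarrow>
    carlitz_1 (fps_nth f 0) = 0 \<and> (\<forall>n. carlitz_1 (fps_nth f (Suc n)) = fps_nth f n)"
proof -
  have "frob f = t_minus_theta * f \<longleftrightarrow>
      (\<forall>n. carlitz_1 (fps_nth f n) = (if n = 0 then 0 else fps_nth f (n - 1)))"
    by (simp add: fps_eq_iff fps_nth_t_minus_theta_mult carlitz_1_def eq_diff_eq)
  also have "\<dots> \<longleftrightarrow> carlitz_1 (fps_nth f 0) = 0 \<and> (\<forall>n. carlitz_1 (fps_nth f (Suc n)) = fps_nth f n)"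
    by (metis Suc_pred' bot_nat_0.not_eq_extremum diff_Suc_1 nat.discI)
  finally show ?thesis .
qed

text \<open>A (q-1)-th root of - theta is a nonzero t-torsion point. Over an algebraically closed
  field the action of t is surjective, so division by t can be repeated forever.\<close>

lemma frob_eigen_exists:
  obtains w :: "'a::{field,finite} Kbar fps" where "frob w = t_minus_theta * w" "fps_nth w 0 \<noteq> 0"
proof -
  let ?q = "CARD('a)"
  have q: "?q > 1" by (rule q_gt_1)
  obtain w0 :: "'a Kbar" where w0: "w0 ^ (?q - 1) = - theta" using nth_root_exists[of "?q - 1"] q by auto
  have "theta \<noteq> (0 :: 'a Kbar)" by (simp add: theta_def)
  then have nz: "w0 \<noteq> 0" using w0 q by (auto simp: power_0_left)
  have "w0 ^ ?q = - theta * w0" using power_minus_mult[of ?q w0] q w0 by simp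
  then have c0: "carlitz_1 w0 = 0" by (simp add: carlitz_1_def)
  have "\<exists>y. carlitz_1 y = x" for x :: "'a Kbar"
  proof -
    let ?P = "monom 1 ?q + [:- x, theta:] :: 'a Kbar poly"
    have "degree [:- x, theta:] < degree (monom (1 :: 'a Kbar) ?q)" using q by (simp add: degree_monom_eq)
    then have "degree ?P > 0" using q by (simp add: degree_add_eq_left degree_monom_eq)
    then obtain y where "poly ?P y = 0" using alg_closed_imp_poly_has_root by blast
    then show ?thesis by (intro exI[of _ y]) (simp add: carlitz_1_def poly_monom algebra_simps eq_neg_iff_add_eq_0)
  qed
  then obtain g :: "'a Kbar \<Rightarrow> 'a Kbar" where g: "\<And>x. carlitz_1 (g x) = x" by metis
  let ?w = "Abs_fps (\<lambda>n. (g ^^ n) w0)"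
  have "frob ?w = t_minus_theta * ?w" unfolding frob_eigen_1_iff by (simp add: c0 g)
  then show ?thesis using nz by (intro that[of ?w]) simp_all
qed

section \<open>The Tate module of a tensor power\<close>

definition over_Ksep :: "'a::{field,finite} Kbar fps \<Rightarrow> bool" where
  "over_Ksep f \<longleftrightarrow> (\<forall>n. fps_nth f n \<in> Ksep)"

lemma const_K_in_Ksep: "const_K c \<in> Ksep" and theta_in_Ksep: "theta \<in> Ksep"
  unfolding const_K_def theta_def by (rule Ksep_to_ac)+

lemma over_Ksep_mult: "over_Ksep f \<Longrightarrow> over_Ksep g \<Longrightarrow> over_Ksep (f * g)"
  by (auto simp: over_Ksep_def fps_mult_nth intro!: Ksep_sum Ksep_mult)

lemma over_Ksep_power: "over_Ksep f \<Longrightarrow> over_Ksep (f ^ n)"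
proof (induction n)
  case 0
  show ?case by (simp add: over_Ksep_def fps_one_nth Ksep_0 Ksep_1)
qed (simp add: over_Ksep_mult)

lemma over_Ksep_lift: "over_Ksep (lift_fps v)"
  by (simp add: over_Ksep_def const_K_in_Ksep)

lemma over_Ksep_t_minus_theta: "over_Ksep t_minus_theta"
proof -
  have "- theta \<in> (Ksep :: 'a Kbar set)"
    using Ksep_mult[OF Ksep_to_ac[of "-1"] theta_in_Ksep] by simp
  then show ?thesis
    by (auto simp: over_Ksep_def t_minus_theta_def fps_X_nth Ksep_0 Ksep_1)
qed

definition map_fps :: "('a::{field,finite} Kbar \<Rightarrow> 'a Kbar) \<Rightarrow> 'a Kbar fps \<Rightarrow> 'a Kbar fps" where
  "map_fps \<sigma> f = Abs_fps (\<lambda>n. \<sigma> (fps_nth f n))"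

lemma fps_nth_map [simp]: "fps_nth (map_fps \<sigma> f) n = \<sigma> (fps_nth f n)"
  by (simp add: map_fps_def)

section \<open>The Galois action on power series\<close>

context
  fixes \<sigma> :: "'a::{field,finite} Kbar \<Rightarrow> 'a Kbar"
  assumes \<sigma>: "\<sigma> \<in> Gal"
begin

lemma Gal_add: "x \<in> Ksep \<Longrightarrow> y \<in> Ksep \<Longrightarrow> \<sigma> (x + y) = \<sigma> x + \<sigma> y"
  and Gal_mult: "x \<in> Ksep \<Longrightarrow> y \<in> Ksep \<Longrightarrow> \<sigma> (x * y) = \<sigma> x * \<sigma> y"
  and Gal_to_ac: "\<sigma> (to_ac c) = to_ac c"
  and Gal_inj: "inj_on \<sigma> Ksep"
  using \<sigma> unfolding Gal_def bij_betw_def by auto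

lemma Gal_0: "\<sigma> 0 = 0" and Gal_1: "\<sigma> 1 = 1"
  using Gal_to_ac[of 0] Gal_to_ac[of 1] by simp_all

lemma Gal_const_K: "\<sigma> (const_K c) = const_K c"
  unfolding const_K_def by (rule Gal_to_ac)

lemma Gal_sum: "(\<And>i. i \<in> I \<Longrightarrow> f i \<in> Ksep) \<Longrightarrow> \<sigma> (\<Sum>i\<in>I. f i) = (\<Sum>i\<in>I. \<sigma> (f i))"
  by (induction I rule: infinite_finite_induct) (simp_all add: Gal_0 Gal_add Ksep_sum)

lemma Gal_power: "x \<in> Ksep \<Longrightarrow> \<sigma> (x ^ n) = \<sigma> x ^ n"
  by (induction n) (simp_all add: Gal_1 Gal_mult Ksep_power)

lemma map_fps_mult: "over_Ksep f \<Longrightarrow> over_Ksep g \<Longrightarrow> map_fps \<sigma> (f * g) = map_fps \<sigma> f * map_fps \<sigma> g"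
  by (rule fps_ext) (simp add: fps_mult_nth over_Ksep_def Gal_sum Ksep_mult Gal_mult)

lemma map_fps_power: "over_Ksep f \<Longrightarrow> map_fps \<sigma> (f ^ n) = map_fps \<sigma> f ^ n"
proof (induction n)
  case 0
  show ?case by (rule fps_ext) (simp add: fps_one_nth Gal_0 Gal_1)
qed (simp add: map_fps_mult over_Ksep_power)

lemma map_fps_lift: "map_fps \<sigma> (lift_fps v) = lift_fps v"
  by (rule fps_ext) (simp add: Gal_const_K)

lemma map_fps_t_minus_theta: "map_fps \<sigma> t_minus_theta = t_minus_theta"
proof (rule fps_ext)
  fix n
  have "\<sigma> (- to_ac c) = - to_ac c" for c using Gal_to_ac[of "- c"] by simp
  then have "\<sigma> (- theta) = - theta" unfolding theta_def .
  then show "fps_nth (map_fps \<sigma> t_minus_theta) n = fps_nth t_minus_theta n"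
    by (simp add: t_minus_theta_def fps_X_nth Gal_0 Gal_1)
qed

lemma frob_map_fps: "over_Ksep f \<Longrightarrow> frob (map_fps \<sigma> f) = map_fps \<sigma> (frob f)"
  by (rule fps_ext) (simp add: over_Ksep_def Gal_power)

end

text \<open>Coordinate \<open>i + 1\<close> of a point of the Tate module, as a power series in \<open>t\<close>, is \<open>t - \<theta>\<close> times
  coordinate \<open>i\<close>; so the coordinate 0, called \<open>f\<close> here, determines the point.\<close>

definition tate_vec :: "nat \<Rightarrow> 'a::{field,finite} Kbar fps \<Rightarrow> nat \<Rightarrow> 'a Kbar vec" where
  "tate_vec d f n = vec d (\<lambda>i. fps_nth (t_minus_theta ^ i * f) n)"

lemma carlitz_t_eq:
  fixes x :: "'a::{field,finite} Kbar vec"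
  assumes x: "x \<in> carrier_vec d" and d: "d > 0"
  shows "carlitz_t d x = vec d (\<lambda>i. theta * x $ i + (if Suc i < d then x $ Suc i else (x $ 0) ^ CARD('a)))"
proof (rule eq_vecI)
  fix i assume "i < dim_vec (vec d (\<lambda>i. theta * x $ i + (if Suc i < d then x $ Suc i else (x $ 0) ^ CARD('a))))"
  then have i: "i < d" by simp
  have dim: "dim_vec x = d" using x by simp
  have "(carlitz_N d *\<^sub>v x) $ i = (\<Sum>j<d. (if j = i then theta else if j = Suc i then 1 else 0) * x $ j)"
    using i dim by (simp add: carlitz_N_def scalar_prod_def atLeast0LessThan)
  also have "\<dots> = (\<Sum>j<d. (if j = i then theta * x $ j else 0) + (if j = Suc i then x $ j else 0))"
    by (intro sum.cong) auto
  also have "\<dots> = theta * x $ i + (if Suc i < d then x $ Suc i else 0)"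
    using i by (simp add: sum.distrib)
  finally have N: "(carlitz_N d *\<^sub>v x) $ i = theta * x $ i + (if Suc i < d then x $ Suc i else 0)" .
  have "(carlitz_E d *\<^sub>v map_vec (\<lambda>y. y ^ CARD('a)) x) $ i
      = (\<Sum>j<d. (if i = d - 1 \<and> j = 0 then 1 else 0) * (x $ j) ^ CARD('a))"
    using i dim by (simp add: carlitz_E_def scalar_prod_def atLeast0LessThan)
  also have "\<dots> = (\<Sum>j<d. if j = 0 then (if i = d - 1 then (x $ j) ^ CARD('a) else 0) else 0)"
    by (intro sum.cong) auto
  also have "\<dots> = (if i = d - 1 then (x $ 0) ^ CARD('a) else 0)" using d by simp
  finally have E: "(carlitz_E d *\<^sub>v map_vec (\<lambda>y. y ^ CARD('a)) x) $ i = (if i = d - 1 then (x $ 0) ^ CARD('a) else 0)" .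
  show "carlitz_t d x $ i = vec d (\<lambda>i. theta * x $ i + (if Suc i < d then x $ Suc i else (x $ 0) ^ CARD('a))) $ i"
    unfolding carlitz_t_def using i N E dim by (auto simp: carlitz_E_def carlitz_N_def)
qed (simp add: carlitz_t_def carlitz_E_def)

context
  fixes d :: nat
  assumes d: "d > 0"
begin

text \<open>In row i the action is multiplication of the series by theta + (t - theta) = t, that is,
  a shift of coefficients. In the last row the equation for \<open>frob f\<close> supplies the
  missing next coordinate.\<close>

lemma carlitz_t_tate_vec:
  fixes f :: "'a::{field,finite} Kbar fps"
  assumes f: "frob f = t_minus_theta ^ d * f"
  shows "carlitz_t d (tate_vec d f n) = (if n = 0 then 0\<^sub>v d else tate_vec d f (n - 1))"
proof (rule eq_vecI)
  fix i assume "i < dim_vec (if n = 0 then 0\<^sub>v d else tate_vec d f (n - 1))"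
  then have i: "i < d" by (auto simp: tate_vec_def split: if_splits)
  let ?g = "t_minus_theta ^ i * f"
  have "(if Suc i < d then tate_vec d f n $ Suc i else (tate_vec d f n $ 0) ^ CARD('a))
      = fps_nth (t_minus_theta * ?g) n"
  proof (cases "Suc i < d")
    case True
    then show ?thesis by (simp add: tate_vec_def mult.assoc)
  next
    case False
    then have "d = Suc i" using i by simp
    then have "fps_nth (t_minus_theta * ?g) n = fps_nth (frob f) n" using f by (simp add: mult.assoc)
    then show ?thesis using False d by (simp add: tate_vec_def)
  qed
  then have "carlitz_t d (tate_vec d f n) $ i = theta * fps_nth ?g n + fps_nth (t_minus_theta * ?g) n"
    using i d by (subst carlitz_t_eq) (simp_all add: tate_vec_def)
  also have "\<dots> = (if n = 0 then 0 else fps_nth ?g (n - 1))"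
    unfolding fps_nth_t_minus_theta_mult by simp
  finally show "carlitz_t d (tate_vec d f n) $ i = (if n = 0 then 0\<^sub>v d else tate_vec d f (n - 1)) $ i"
    using i by (simp add: tate_vec_def)
qed (simp add: carlitz_t_def carlitz_E_def tate_vec_def)

lemma carlitz_t_iter_tate_vec:
  fixes f :: "'a::{field,finite} Kbar fps"
  assumes f: "frob f = t_minus_theta ^ d * f"
  shows "(carlitz_t d ^^ i) (tate_vec d f (i + n)) = tate_vec d f n"
  by (induction i) (simp_all add: funpow_swap1 carlitz_t_tate_vec[OF f])

lemma tate_vec_in_tate_module:
  assumes f: "frob f = t_minus_theta ^ d * f" and K: "over_Ksep f"
  shows "tate_vec d f \<in> tate_module d"
proof -
  have "(carlitz_t d ^^ Suc n) (tate_vec d f n) = 0\<^sub>v d" for n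
    using carlitz_t_iter_tate_vec[OF f, of n 0] by (simp add: carlitz_t_tate_vec[OF f])
  moreover have "over_Ksep (t_minus_theta ^ i * f)" for i
    by (intro over_Ksep_mult over_Ksep_power over_Ksep_t_minus_theta K)
  ultimately show ?thesis
    by (simp add: tate_module_def torsion_def carlitz_t_tate_vec[OF f] del: funpow.simps)
       (simp add: tate_vec_def over_Ksep_def)
qed

text \<open>The rows of compatibility with t say that each coordinate series is t - theta times the
  previous one; the last row closes this chain with the Frobenius equation for coordinate 0.\<close>

lemma tate_moduleE:
  assumes x: "x \<in> tate_module d"
  obtains f where "x = tate_vec d f" "frob f = t_minus_theta ^ d * f" "over_Ksep f"
proof -
  have carrier: "x n \<in> carrier_vec d" and sep: "i < d \<Longrightarrow> x n $ i \<in> Ksep" for n i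
    using x by (auto simp: tate_module_def torsion_def)
  have t0: "carlitz_t d (x 0) = 0\<^sub>v d" and tSuc: "carlitz_t d (x (Suc n)) = x n" for n
    using x by (auto simp: tate_module_def torsion_def dest!: spec[of _ 0])
  have t: "carlitz_t d (x n) $ i = (if n = 0 then 0 else x (n - 1) $ i)" if "i < d" for n i
    using that by (cases n) (simp_all add: t0 tSuc)
  let ?g = "\<lambda>i. Abs_fps (\<lambda>n. x n $ i)"
  have rel: "theta * x n $ i + (if Suc i < d then x n $ Suc i else (x n $ 0) ^ CARD('a))
      = (if n = 0 then 0 else x (n - 1) $ i)" if "i < d" for n i
    using t[OF that, of n] that by (simp add: carlitz_t_eq[OF carrier d])
  have step: "?g (Suc i) = t_minus_theta * ?g i" if "Suc i < d" for i
    using rel[of i] that by (intro fps_ext) (simp add: fps_nth_t_minus_theta_mult eq_diff_eq add.commute)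
  have pow: "?g i = t_minus_theta ^ i * ?g 0" if "i < d" for i
    using that by (induction i) (simp_all add: step mult.assoc)
  have "frob (?g 0) = t_minus_theta * ?g (d - 1)"
    using rel[of "d - 1"] d by (intro fps_ext) (simp add: fps_nth_t_minus_theta_mult eq_diff_eq add.commute)
  also have "\<dots> = t_minus_theta ^ d * ?g 0"
    using pow[of "d - 1"] d by (cases d) (simp_all add: mult.assoc)
  finally have frob: "frob (?g 0) = t_minus_theta ^ d * ?g 0" .
  have "x n = tate_vec d (?g 0) n" for n
  proof (rule eq_vecI)
    fix i assume "i < dim_vec (tate_vec d (?g 0) n)"
    then have i: "i < d" by (simp add: tate_vec_def)
    have "x n $ i = fps_nth (?g i) n" by simp
    then show "x n $ i = tate_vec d (?g 0) n $ i" using i unfolding pow[OF i] by (simp add: tate_vec_def)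
  qed (use carrier[of n] in \<open>simp add: tate_vec_def\<close>)
  then have "x = tate_vec d (?g 0)" by (rule ext)
  moreover have "over_Ksep (?g 0)" using sep[OF d] by (simp add: over_Ksep_def)
  ultimately show ?thesis using frob by (intro that)
qed

text \<open>As t acts by a shift, the truncated sum is the n-th coefficient of a Cauchy
  product.\<close>

lemma tate_smult_tate_vec:
  fixes f :: "'a::{field,finite} Kbar fps"
  assumes f: "frob f = t_minus_theta ^ d * f"
  shows "tate_smult d u (tate_vec d f) = tate_vec d (lift_fps u * f)"
proof
  fix n
  have iter: "(carlitz_t d ^^ i) (tate_vec d f n) = tate_vec d f (n - i)" if "i \<le> n" for i
    using carlitz_t_iter_tate_vec[OF f, of i "n - i"] that by simp
  have "(\<Sum>i\<le>n. const_K (fps_nth u i) * ((carlitz_t d ^^ i) (tate_vec d f n) $ j))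
      = fps_nth (t_minus_theta ^ j * (lift_fps u * f)) n" if "j < d" for j
  proof -
    have "(\<Sum>i\<le>n. const_K (fps_nth u i) * ((carlitz_t d ^^ i) (tate_vec d f n) $ j))
        = (\<Sum>i\<le>n. fps_nth (lift_fps u) i * fps_nth (t_minus_theta ^ j * f) (n - i))"
      using that by (intro sum.cong) (simp_all add: iter, simp add: tate_vec_def)
    also have "\<dots> = fps_nth (lift_fps u * (t_minus_theta ^ j * f)) n"
      by (simp add: fps_mult_nth atLeast0AtMost)
    finally show ?thesis by (simp add: mult.left_commute)
  qed
  then show "tate_smult d u (tate_vec d f) n = tate_vec d (lift_fps u * f) n"
    unfolding tate_smult_def by (intro eq_vecI) (simp_all add: tate_vec_def)
qed

lemma map_tate_vec:
  assumes "\<sigma> \<in> Gal" "over_Ksep f"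
  shows "(\<lambda>n. map_vec \<sigma> (tate_vec d f n)) = tate_vec d (map_fps \<sigma> f)"
proof
  fix n
  have "map_fps \<sigma> (t_minus_theta ^ i * f) = t_minus_theta ^ i * map_fps \<sigma> f" for i
    using assms by (simp add: map_fps_mult map_fps_power map_fps_t_minus_theta over_Ksep_power over_Ksep_t_minus_theta)
  from arg_cong[OF this, of "\<lambda>f. fps_nth f n"]
  show "map_vec \<sigma> (tate_vec d f n) = tate_vec d (map_fps \<sigma> f) n"
    by (intro eq_vecI) (simp_all add: tate_vec_def)
qed

lemma tate_vec_inject: "tate_vec d f = tate_vec d g \<Longrightarrow> f = g"
proof (rule fps_ext)
  fix n assume "tate_vec d f = tate_vec d g"
  then have "tate_vec d f n $ 0 = tate_vec d g n $ 0" by simp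
  then show "fps_nth f n = fps_nth g n" using d by (simp add: tate_vec_def)
qed

end

lemma fps_nth_power_0_nonzero: "fps_nth u 0 \<noteq> 0 \<Longrightarrow> fps_nth (u ^ d) 0 \<noteq> (0 :: 'b::idom)"
  by (simp add: fps_nth_power_0)

section \<open>The Galois character of the Carlitz module and its powers\<close>

context
  fixes w :: "'a::{field,finite} Kbar fps"
  assumes w: "frob w = t_minus_theta * w" "fps_nth w 0 \<noteq> 0"
begin

lemma over_Ksep_w: "over_Ksep w"
  unfolding over_Ksep_def
  using torsion_point_in_Ksep[of "fps_nth w"] w unfolding frob_eigen_1_iff by blast

lemma frob_w_power: "frob (w ^ d) = t_minus_theta ^ d * w ^ d"
  by (simp add: frob_power w power_mult_distrib)

text \<open>The automorphism commutes with \<open>frob\<close> and fixes t - theta, so the image of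
  w solves the same equation. The constant term of u is nonzero because \<sigma> is
  injective.\<close>

lemma Gal_cocycle:
  assumes "\<sigma> \<in> Gal"
  obtains u where "map_fps \<sigma> w = lift_fps u * w" "fps_nth u 0 \<noteq> 0"
proof -
  have "frob (map_fps \<sigma> w) = map_fps \<sigma> (t_minus_theta * w)"
    using frob_map_fps[OF assms over_Ksep_w] w(1) by simp
  also have "\<dots> = t_minus_theta * map_fps \<sigma> w"
    by (simp add: map_fps_mult[OF assms over_Ksep_t_minus_theta over_Ksep_w] map_fps_t_minus_theta[OF assms])
  finally have "frob (map_fps \<sigma> w) = t_minus_theta ^ 1 * map_fps \<sigma> w" by simp
  then obtain u where u: "map_fps \<sigma> w = lift_fps u * w"
    using frob_eigen_unique[of w 1 "map_fps \<sigma> w"] w by auto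
  have "fps_nth u 0 \<noteq> 0"
  proof
    assume "fps_nth u 0 = 0"
    then have "\<sigma> (fps_nth w 0) = 0" using arg_cong[OF u, of "\<lambda>f. fps_nth f 0"] by simp
    then have "\<sigma> (fps_nth w 0) = \<sigma> 0" by (simp add: Gal_0[OF assms])
    then show False using inj_onD[OF Gal_inj[OF assms]] over_Ksep_w Ksep_0 w(2) unfolding over_Ksep_def by blast
  qed
  then show ?thesis using u that by blast
qed

text \<open>Every Tate point comes from some v * w^d with v over F_q, on which \<sigma> acts as u^d.
  The point of w^d itself shows uniqueness, as w^d can be cancelled.\<close>

lemma galois_rep_eq:
  assumes d: "d > 0" and \<sigma>: "\<sigma> \<in> Gal" and u: "map_fps \<sigma> w = lift_fps u * w" "fps_nth u 0 \<noteq> 0"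
  shows "galois_rep d \<sigma> = u ^ d"
  unfolding galois_rep_def
proof (rule the_equality)
  have w0: "fps_nth (w ^ d) 0 \<noteq> 0" using w(2) by (rule fps_nth_power_0_nonzero)
  have smult: "(\<lambda>n. map_vec \<sigma> (x n)) = tate_smult d (u ^ d) x" if x: "x \<in> tate_module d" for x
  proof -
    obtain f where f: "x = tate_vec d f" "frob f = t_minus_theta ^ d * f" "over_Ksep f"
      using tate_moduleE[OF d x] by blast
    obtain v where v: "f = lift_fps v * w ^ d" by (rule frob_eigen_unique[OF frob_w_power w0 f(2)])
    have "map_fps \<sigma> f = lift_fps (u ^ d) * f"
      unfolding v using u(1)
      by (simp add: map_fps_mult[OF \<sigma> over_Ksep_lift over_Ksep_power[OF over_Ksep_w]] map_fps_lift[OF \<sigma>]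
          map_fps_power[OF \<sigma> over_Ksep_w] lift_fps_power power_mult_distrib mult_ac)
    then show ?thesis
      unfolding f(1) by (simp add: map_tate_vec[OF d \<sigma> f(3)] tate_smult_tate_vec[OF d f(2)])
  qed
  moreover have "is_unit (u ^ d)" using u(2) by (simp add: fps_is_unit_iff fps_nth_power_0)
  ultimately show "is_unit (u ^ d) \<and> (\<forall>x\<in>tate_module d. (\<lambda>n. map_vec \<sigma> (x n)) = tate_smult d (u ^ d) x)" by blast
  fix u' assume u': "is_unit u' \<and> (\<forall>x\<in>tate_module d. (\<lambda>n. map_vec \<sigma> (x n)) = tate_smult d u' x)"
  have "tate_vec d (w ^ d) \<in> tate_module d"
    by (rule tate_vec_in_tate_module[OF d frob_w_power over_Ksep_power[OF over_Ksep_w]])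
  then have "tate_smult d u' (tate_vec d (w ^ d)) = tate_smult d (u ^ d) (tate_vec d (w ^ d))"
    using u' smult by metis
  then have "lift_fps u' * w ^ d = lift_fps (u ^ d) * w ^ d"
    unfolding tate_smult_tate_vec[OF d frob_w_power] by (rule tate_vec_inject[OF d])
  moreover have "w ^ d \<noteq> 0" using w0 by auto
  ultimately show "u' = u ^ d" by (intro lift_fps_inject) (metis mult_right_cancel)
qed

text \<open>Besides w, the series v w also solves the equation with nonzero constant term. With n =
  N - 1, the n-th coefficients of both are roots of one irreducible polynomial, so some automorphism
  carries one to the other.\<close>

lemma Gal_surjective_mod:
  fixes v :: "'a fps"
  assumes v: "fps_nth v 0 \<noteq> 0" and N: "N > 0"
  shows "\<exists>\<sigma>\<in>Gal. \<exists>u. map_fps \<sigma> w = lift_fps u * w \<and> fps_nth u 0 \<noteq> 0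
    \<and> (\<forall>k<N. fps_nth u k = fps_nth v k)"
proof -
  let ?w' = "lift_fps v * w"
  have w': "frob ?w' = t_minus_theta * ?w'" "fps_nth ?w' 0 \<noteq> 0"
    using v w by (simp_all add: frob_mult frob_lift mult.left_commute)
  obtain n where n: "N = Suc n" using N by (cases N) auto
  have root: "poly (map_poly to_ac (map_poly to_fract (carlitz_cyclotomic n))) (fps_nth z n) = 0"
    if "frob z = t_minus_theta * z" "fps_nth z 0 \<noteq> 0" for z :: "'a Kbar fps"
    using torsion_point_root[of "fps_nth z"] that unfolding frob_eigen_1_iff by blast
  obtain h where h: "h (fps_nth w n) = fps_nth ?w' n" "\<And>x y. h (x + y) = h x + h y"
    "\<And>x y. h (x * y) = h x * h y" "\<And>c. h (to_ac c) = to_ac c" "inj h"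
    using conjugating_hom[OF irreducible_carlitz_cyclotomic root[OF w] root[OF w']] by metis
  have h_1: "h (carlitz_1 x) = carlitz_1 (h x)" for x
  proof -
    have "h (x ^ k) = h x ^ k" for k by (induction k) (use h(4)[of 1] in \<open>simp_all add: h(3)\<close>)
    then show ?thesis by (simp add: carlitz_1_def h(2,3,4) theta_def)
  qed
  \<comment> \<open>Downward from n: each lower coefficient is the image under t of the next one,
    and h commutes with t.\<close>
  have h_w: "h (fps_nth w k) = fps_nth ?w' k" if "k \<le> n" for k
    using that
  proof (induction rule: inc_induct)
    case (step k)
    have "fps_nth w k = carlitz_1 (fps_nth w (Suc k))" "fps_nth ?w' k = carlitz_1 (fps_nth ?w' (Suc k))"
      using w(1) w'(1) unfolding frob_eigen_1_iff by simp_all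
    then show ?case using step.IH h_1 by metis
  qed (rule h(1))
  let ?\<sigma> = "restrict h Ksep"
  have \<sigma>: "?\<sigma> \<in> Gal" by (rule restrict_hom_in_Gal[OF h(2-5)])
  obtain u where u: "map_fps ?\<sigma> w = lift_fps u * w" "fps_nth u 0 \<noteq> 0" by (rule Gal_cocycle[OF \<sigma>])
  have eq: "fps_nth (lift_fps u * w) k = fps_nth (lift_fps v * w) k" if "k < N" for k
  proof -
    have "fps_nth (map_fps ?\<sigma> w) k = h (fps_nth w k)"
      using over_Ksep_w by (simp add: over_Ksep_def)
    then show ?thesis using h_w[of k] that n u(1) by simp
  qed
  \<comment> \<open>The system is triangular with the nonzero diagonal entry
    \<open>fps_nth w 0\<close>.\<close>
  have "fps_nth u k = fps_nth v k" if "k < N" for k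
    using that
  proof (induction k rule: less_induct)
    case (less k)
    have "(\<Sum>i<k. fps_nth (lift_fps u) i * fps_nth w (k - i)) = (\<Sum>i<k. fps_nth (lift_fps v) i * fps_nth w (k - i))"
      using less by (intro sum.cong) simp_all
    moreover have split: "fps_nth (f * w) k = (\<Sum>i<k. fps_nth f i * fps_nth w (k - i)) + fps_nth f k * fps_nth w 0" for f
      by (simp add: fps_mult_nth atLeast0AtMost lessThan_Suc_atMost[symmetric])
    ultimately have "fps_nth (lift_fps u) k * fps_nth w 0 = fps_nth (lift_fps v) k * fps_nth w 0"
      using eq[OF less.prems] unfolding split by simp
    then show ?case using w(2) by simp
  qed
  then show ?thesis using \<sigma> u by blast
qed

end

section \<open>The density\<close>

theorem theorem6p6:
  fixes d d' e p :: nat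
  assumes "p = CHAR('a::{field,finite})"
    and "d = p ^ e * d'"
    and "d' > 0"
    and "coprime d' p"
  shows "density Gal (galois_rep d :: ('a Kbar \<Rightarrow> 'a Kbar) \<Rightarrow> 'a fps) = ereal (1 / real (p ^ e))"
proof -
  let ?q = "CARD('a)" and ?\<rho> = "galois_rep d :: ('a Kbar \<Rightarrow> 'a Kbar) \<Rightarrow> 'a fps"
  have q: "?q > 1" by (rule q_gt_1)
  have pe: "p ^ e > 0" using prime_gt_0_nat[OF prime_CHAR[where 'a = 'a]] assms(1) by simp
  then have d: "d > 0" using assms(2,3) by simp
  obtain w :: "'a Kbar fps" where w: "frob w = t_minus_theta * w" "fps_nth w 0 \<noteq> 0"
    by (rule frob_eigen_exists)
  have "\<exists>u. map_fps \<sigma> w = lift_fps u * w \<and> fps_nth u 0 \<noteq> 0" if "\<sigma> \<in> Gal" for \<sigma>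
    using Gal_cocycle[OF w that] by blast
  then obtain u where u: "\<And>\<sigma>. \<sigma> \<in> Gal \<Longrightarrow> map_fps \<sigma> w = lift_fps (u \<sigma>) * w"
    and u0: "\<And>\<sigma>. \<sigma> \<in> Gal \<Longrightarrow> fps_nth (u \<sigma>) 0 \<noteq> 0" by metis
  have rep: "?\<rho> \<sigma> = u \<sigma> ^ d" if "\<sigma> \<in> Gal" for \<sigma>
    by (rule galois_rep_eq[OF w d that u[OF that] u0[OF that]])
  \<comment> \<open>The series chosen for \<sigma> is the one produced by
    \<open>Gal_surjective_mod\<close>, since w can be cancelled.\<close>
  have surj: "\<exists>z\<in>u ` Gal. z mod fps_X ^ N = v mod fps_X ^ N" if N: "N > 0" and v: "fps_nth v 0 \<noteq> 0" for N v
  proof -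
    obtain \<sigma> z where z: "\<sigma> \<in> Gal" "map_fps \<sigma> w = lift_fps z * w" "\<forall>k<N. fps_nth z k = fps_nth v k"
      using Gal_surjective_mod[OF w v N] by blast
    have "w \<noteq> 0" using w(2) by auto
    then have "u \<sigma> = z" using u[OF z(1)] z(2) by (intro lift_fps_inject) (metis mult_right_cancel)
    then have "u \<sigma> mod fps_X ^ N = v mod fps_X ^ N"
      using z(3) by (simp add: fps_mod_X_power fps_cutoff_eq_fps_cutoff_iff)
    then show ?thesis using z(1) by blast
  qed
  have order_eq: "image_order Gal ?\<rho> N = card ((\<lambda>z. z ^ (p ^ e * d') mod fps_X ^ N) ` u ` Gal)" for N
    unfolding image_order_def image_image by (intro arg_cong[of _ _ card] image_cong) (simp_all only: rep assms(2)[symmetric])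
  have lower: "?q ^ (M - 1) \<le> image_order Gal ?\<rho> N"
    and upper: "image_order Gal ?\<rho> N \<le> ?q ^ M"
    if N: "N > 0" and M: "\<And>i. N \<le> p ^ e * i \<longleftrightarrow> M \<le> i" for N M
    unfolding order_eq using image_order_power[OF assms(1,3,4) M surj[OF N] N] by blast+
  have "infinite (?\<rho> ` Gal)"
  proof
    assume fin: "finite (?\<rho> ` Gal)"
    let ?c = "card (?\<rho> ` Gal)"
    \<comment> \<open>At N = p^e (c + 1) the rounded quotient is c + 1, so an image of size c would
      have at least q^c > c residues.\<close>
    have "?q ^ (Suc ?c - 1) \<le> image_order Gal ?\<rho> (p ^ e * Suc ?c)"
      using pe by (intro lower) (simp, subst mult_le_cancel1, simp)
    also have "\<dots> = card ((\<lambda>z. z mod fps_X ^ (p ^ e * Suc ?c)) ` ?\<rho> ` Gal)"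
      by (simp only: image_order_def image_image)
    also have "\<dots> \<le> ?c" by (rule card_image_le[OF fin])
    finally show False using power_gt_expt[of ?q ?c] q by simp
  qed
  moreover have "0 \<notin> ?\<rho> ` Gal" using rep u0 by force
  ultimately have "ereal_of_enat (hull_dim (?\<rho> ` Gal)) = 1"
    by (simp add: hull_dim_eq_1 one_enat_def)
  then show ?thesis
    unfolding density_def using limsup_log_card[OF q pe lower upper] by simp
qed

end
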